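(* Let $R=\bigoplus_{i\ge0}R_i$ be a graded domain of Krull dimension $d\ge2$ with $\dim(R_0)\ge1$. Then for every $v\in\mathrm{Um}_{d+1}(R,R_+)$ there exists $\alpha\in\mathrm{GL}_{d+1}(R,R_+)$ with $v\alpha=e_1$. Consequently $\mathrm{Um}_{d+1}(R)=e_1\mathrm{H}_{d+1}(R)$, i.e. every unimodular row of length $d+1$ is of the form $e_1\alpha$ with $\alpha\in \mathrm H_{d+1}(R)$.
   Context: Rings are commutative Noetherian with $1\ne0$ of finite Krull dimension; graded means non-trivially $\mathbb N$-graded, $R_+=\bigoplus_{i\ge1}R_i$. $\mathrm{Um}_n(B)$: unimodular rows of length $n$; $\mathrm{Um}_n(B,I)=\{v\in\mathrm{Um}_n(B):v\equiv e_1\bmod I\}$; $\mathrm{GL}_n(B,I)=\{\alpha\in\mathrm{GL}_n(B):\alpha\equiv\mathrm{Id}\bmod I\}$; $e_1=(1,0,\dots,0)$. $\mathrm H_n(B)=\{\alpha\in\mathrm{GL}_n(B):\exists\,\theta(T)\in\mathrm{GL}_n(B[T])\text{ with }\theta(0)=\mathrm{Id},\ \theta(1)=\alpha\}$. For a subgroup $G\subset\mathrm{GL}_n(B)$, $e_1G=\{e_1g:g\in G\}$. *)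

theory Defs
  imports "HOL-Computational_Algebra.Polynomial"
begin

section \<open>Ideals, primes, Krull dimension (relative to a subring S of the ambient ring)\<close>

definition ideal_of :: "'a::comm_ring_1 set \<Rightarrow> 'a set \<Rightarrow> bool" where
  "ideal_of S I \<longleftrightarrow> I \<subseteq> S \<and> 0 \<in> I \<and> (\<forall>x\<in>I. \<forall>y\<in>I. x + y \<in> I)
     \<and> (\<forall>r\<in>S. \<forall>x\<in>I. r * x \<in> I)"

definition prime_ideal_of :: "'a::comm_ring_1 set \<Rightarrow> 'a set \<Rightarrow> bool" where
  "prime_ideal_of S P \<longleftrightarrow> ideal_of S P \<and> P \<noteq> S
     \<and> (\<forall>a\<in>S. \<forall>b\<in>S. a * b \<in> P \<longrightarrow> a \<in> P \<or> b \<in> P)"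

definition krull_dim_ge :: "'a::comm_ring_1 set \<Rightarrow> nat \<Rightarrow> bool" where
  "krull_dim_ge S n \<longleftrightarrow> (\<exists>P :: nat \<Rightarrow> 'a set.
     (\<forall>i\<le>n. prime_ideal_of S (P i)) \<and> (\<forall>i<n. P i \<subset> P (Suc i)))"

definition has_krull_dim :: "'a::comm_ring_1 set \<Rightarrow> nat \<Rightarrow> bool" where
  "has_krull_dim S d \<longleftrightarrow> krull_dim_ge S d \<and> \<not> krull_dim_ge S (Suc d)"

definition noetherian_ring :: "'a::comm_ring_1 itself \<Rightarrow> bool" where
  "noetherian_ring _ \<longleftrightarrow> (\<forall>I :: 'a set. ideal_of UNIV I \<longrightarrow>
     (\<exists>F. finite F \<and> I = {\<Sum>x\<in>F. c x * x | c. True}))"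

definition graded_ring :: "(nat \<Rightarrow> 'a::comm_ring_1 set) \<Rightarrow> bool" where
  "graded_ring Rg \<longleftrightarrow>
     (\<forall>i. 0 \<in> Rg i \<and> (\<forall>x\<in>Rg i. \<forall>y\<in>Rg i. x + y \<in> Rg i) \<and> (\<forall>x\<in>Rg i. - x \<in> Rg i))
   \<and> (\<forall>i j x y. x \<in> Rg i \<longrightarrow> y \<in> Rg j \<longrightarrow> x * y \<in> Rg (i + j))
   \<and> (\<forall>x. \<exists>!f. (\<forall>i. f i \<in> Rg i) \<and> finite {i. f i \<noteq> 0} \<and> x = (\<Sum>i\<in>{i. f i \<noteq> 0}. f i))
   \<and> (\<exists>i\<ge>1. Rg i \<noteq> {0})"

definition Rplus :: "(nat \<Rightarrow> 'a::comm_ring_1 set) \<Rightarrow> 'a set" where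
  "Rplus Rg = {x. \<exists>f. (\<forall>i. f i \<in> Rg i) \<and> finite {i. f i \<noteq> 0}
                 \<and> x = (\<Sum>i\<in>{i. f i \<noteq> 0}. f i) \<and> f 0 = 0}"

section \<open>Rows and matrices of size n (indices 0..n-1; entries outside are ignored)\<close>

definition unimodular :: "nat \<Rightarrow> (nat \<Rightarrow> 'a::comm_ring_1) \<Rightarrow> bool" where
  "unimodular n v \<longleftrightarrow> (\<exists>w. (\<Sum>i<n. v i * w i) = 1)"

definition e1 :: "nat \<Rightarrow> 'a::comm_ring_1" where
  "e1 i = (if i = 0 then 1 else 0)"

definition Um_rel :: "nat \<Rightarrow> 'a::comm_ring_1 set \<Rightarrow> (nat \<Rightarrow> 'a) set" where
  "Um_rel n I = {v. unimodular n v \<and> (\<forall>i<n. v i - e1 i \<in> I)}"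

definition row_mult :: "nat \<Rightarrow> (nat \<Rightarrow> 'a::comm_ring_1) \<Rightarrow> (nat \<Rightarrow> nat \<Rightarrow> 'a) \<Rightarrow> nat \<Rightarrow> 'a" where
  "row_mult n v A = (\<lambda>j. \<Sum>i<n. v i * A i j)"

definition idm :: "nat \<Rightarrow> nat \<Rightarrow> 'a::comm_ring_1" where
  "idm i j = (if i = j then 1 else 0)"

definition GL :: "nat \<Rightarrow> (nat \<Rightarrow> nat \<Rightarrow> 'a::comm_ring_1) set" where
  "GL n = {A. \<exists>B. \<forall>i<n. \<forall>j<n. (\<Sum>k<n. A i k * B k j) = idm i j \<and> (\<Sum>k<n. B i k * A k j) = idm i j}"

definition GL_rel :: "nat \<Rightarrow> 'a::comm_ring_1 set \<Rightarrow> (nat \<Rightarrow> nat \<Rightarrow> 'a) set" where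
  "GL_rel n I = {A \<in> GL n. \<forall>i<n. \<forall>j<n. A i j - idm i j \<in> I}"

definition H :: "nat \<Rightarrow> (nat \<Rightarrow> nat \<Rightarrow> 'a::comm_ring_1) set" where
  "H n = {A \<in> GL n. \<exists>\<theta> :: nat \<Rightarrow> nat \<Rightarrow> 'a poly. \<theta> \<in> GL n \<and>
            (\<forall>i<n. \<forall>j<n. poly (\<theta> i j) 0 = idm i j \<and> poly (\<theta> i j) 1 = A i j)}"

end

theory Submission
  imports Defs
begin

text \<open>
  The ring endomorphisms \<open>\<phi>\<^sub>c: \<Sum> x\<^sub>i \<mapsto> \<Sum> c\<^sup>i x\<^sub>i\<close> connect a row \<open>v = \<phi>\<^sub>1 v\<close> to its degree zero part \<open>\<phi>\<^sub>0 v\<close>.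
  Quillen patching: if \<open>v\<close> becomes equivalent to a row of degree zero after inverting \<open>s \<in> R\<^sub>0\<close>, then
  \<open>\<phi>\<^bsub>c+ts\<^esub> v\<close> and \<open>\<phi>\<^sub>c v\<close> are equivalent over \<open>R\<close>. So it suffices to treat the localization of \<open>R\<close> at
  \<open>R\<^sub>0 \ m\<close> for a prime \<open>m \<supseteq> R\<^sub>+\<close>, which can be taken to contain some nonzero \<open>s \<in> R\<^sub>0\<close>. Cut the spectrum
  into \<open>s = 0\<close> and \<open>s \<noteq> 0\<close>. Both parts have dimension less than \<open>d\<close>: the first because \<open>R\<close> is a domain, the second
  because a prime \<open>P\<close> is at most one step higher than the largest graded prime below it and, when \<open>s \<notin> P\<close>,
  there is still room above that graded prime inside \<open>m\<close>. Heitmann's non-Noetherian form of the stable range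
  theorem, applied to both parts in turn, shortens the row.

  Localizations are avoided by working with pairs of matrices over \<open>R\<close> whose products are a scalar \<open>u\<close>.
\<close>

section \<open>Ideals and primes\<close>

lemma ideal_of_UNIV_iff:
  "ideal_of UNIV I \<longleftrightarrow> 0 \<in> I \<and> (\<forall>x\<in>I. \<forall>y\<in>I. x + y \<in> I) \<and> (\<forall>r. \<forall>x\<in>I. r * x \<in> I)"
  by (simp add: ideal_of_def)

lemma ideal_zero: "ideal_of UNIV I \<Longrightarrow> 0 \<in> I"
  and ideal_add: "ideal_of UNIV I \<Longrightarrow> x \<in> I \<Longrightarrow> y \<in> I \<Longrightarrow> x + y \<in> I"
  and ideal_mult_left: "ideal_of UNIV I \<Longrightarrow> x \<in> I \<Longrightarrow> r * x \<in> I"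
  by (auto simp: ideal_of_UNIV_iff)

lemma ideal_mult_right: "ideal_of UNIV I \<Longrightarrow> x \<in> I \<Longrightarrow> x * r \<in> I"
  using ideal_mult_left[of I x r] by (simp add: mult.commute)

lemma ideal_uminus: "ideal_of UNIV I \<Longrightarrow> x \<in> I \<Longrightarrow> - x \<in> I"
  using ideal_mult_left[of I x "-1"] by simp

lemma ideal_diff: "ideal_of UNIV I \<Longrightarrow> x \<in> I \<Longrightarrow> y \<in> I \<Longrightarrow> x - y \<in> I"
  using ideal_add[of I x "-y"] ideal_uminus[of I y] by simp

lemma ideal_sum: "ideal_of UNIV I \<Longrightarrow> (\<And>i. i \<in> A \<Longrightarrow> f i \<in> I) \<Longrightarrow> sum f A \<in> I"
  by (induction A rule: infinite_finite_induct) (auto simp: ideal_zero ideal_add)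

lemma ideal_add_cancel: "ideal_of UNIV I \<Longrightarrow> y \<in> I \<Longrightarrow> x + y \<in> I \<longleftrightarrow> x \<in> I"
  using ideal_add[of I x y] ideal_diff[of I "x + y" y] by auto

text \<open>Membership carries explicit coefficients because these later feed the column
  operations.\<close>

definition ideal_join :: "nat \<Rightarrow> (nat \<Rightarrow> 'a::comm_ring_1) \<Rightarrow> 'a set \<Rightarrow> 'a set" where
  "ideal_join n g I = {y. \<exists>c. \<exists>z\<in>I. y = (\<Sum>i<n. c i * g i) + z}"

lemma ideal_join_superset: "I \<subseteq> ideal_join n g I"
  unfolding ideal_join_def by (auto intro!: exI[of _ "\<lambda>_. 0"])

lemma ideal_join_generator:
  assumes "ideal_of UNIV I" "i < n"
  shows "g i \<in> ideal_join n g I"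
proof -
  have "g i = (\<Sum>j<n. (if j = i then 1 else 0) * g j) + 0"
    using assms by (simp add: if_distrib[of "\<lambda>x. x * _"] cong: if_cong)
  then show ?thesis using ideal_zero[OF assms(1)] unfolding ideal_join_def by (intro CollectI exI bexI)
qed

lemma ideal_join_ideal:
  assumes I: "ideal_of UNIV I"
  shows "ideal_of UNIV (ideal_join n g I)"
  unfolding ideal_of_UNIV_iff
proof (intro conjI allI ballI)
  show "0 \<in> ideal_join n g I" using ideal_join_superset ideal_zero[OF I] by blast
  fix x y assume "x \<in> ideal_join n g I" "y \<in> ideal_join n g I"
  then obtain c z c' z' where *: "x = (\<Sum>i<n. c i * g i) + z" "y = (\<Sum>i<n. c' i * g i) + z'" "z \<in> I" "z' \<in> I"
    unfolding ideal_join_def by blast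
  then have "x + y = (\<Sum>i<n. (c i + c' i) * g i) + (z + z')"
    by (simp add: sum.distrib algebra_simps)
  then show "x + y \<in> ideal_join n g I"
    using ideal_add[OF I *(3,4)] unfolding ideal_join_def by (intro CollectI exI bexI)
next
  fix r x assume "x \<in> ideal_join n g I"
  then obtain c z where *: "x = (\<Sum>i<n. c i * g i) + z" "z \<in> I"
    unfolding ideal_join_def by blast
  then have "r * x = (\<Sum>i<n. (r * c i) * g i) + r * z"
    by (simp add: sum_distrib_left algebra_simps)
  then show "r * x \<in> ideal_join n g I"
    using ideal_mult_left[OF I *(2)] unfolding ideal_join_def by (intro CollectI exI bexI)
qed

lemma ideal_join_single: "y \<in> ideal_join 1 (\<lambda>_. a) I \<longleftrightarrow> (\<exists>r. \<exists>z\<in>I. y = r * a + z)"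
  unfolding ideal_join_def by (auto intro: exI[of _ "\<lambda>_. _"])

lemma prime_ideal_ideal: "prime_ideal_of S P \<Longrightarrow> ideal_of S P"
  by (simp add: prime_ideal_of_def)

lemma prime_ideal_one: "prime_ideal_of UNIV P \<Longrightarrow> 1 \<notin> P"
  unfolding prime_ideal_of_def ideal_of_UNIV_iff by (metis UNIV_eq_I mult.right_neutral)

lemma prime_ideal_mult_iff: "prime_ideal_of UNIV P \<Longrightarrow> x * y \<in> P \<longleftrightarrow> x \<in> P \<or> y \<in> P"
  using ideal_mult_left ideal_mult_right unfolding prime_ideal_of_def by blast

lemma prime_ideal_power: "prime_ideal_of UNIV P \<Longrightarrow> x ^ k \<in> P \<Longrightarrow> x \<in> P"
  by (induction k) (auto simp: prime_ideal_one prime_ideal_mult_iff)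

lemma prime_idealI:
  assumes "ideal_of UNIV P" "1 \<notin> P" "\<And>x y. x * y \<in> P \<Longrightarrow> x \<in> P \<or> y \<in> P"
  shows "prime_ideal_of UNIV P"
  using assms unfolding prime_ideal_of_def by auto

section \<open>Multiplicative sets and the primes that avoid them\<close>

definition mult_closed :: "'a::comm_ring_1 set \<Rightarrow> bool" where
  "mult_closed U \<longleftrightarrow> 1 \<in> U \<and> (\<forall>x\<in>U. \<forall>y\<in>U. x * y \<in> U)"

definition mult_adjoin :: "'a::comm_ring_1 set \<Rightarrow> 'a \<Rightarrow> 'a set" where
  "mult_adjoin U b = {y. \<exists>u\<in>U. \<exists>k. y = u * b ^ k}"

lemma subset_mult_adjoin: "U \<subseteq> mult_adjoin U b"
proof
  fix x assume "x \<in> U"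
  moreover have "x = x * b ^ 0" by simp
  ultimately show "x \<in> mult_adjoin U b" unfolding mult_adjoin_def by blast
qed

lemma mult_adjoin_self: "mult_closed U \<Longrightarrow> b \<in> mult_adjoin U b"
  unfolding mult_adjoin_def mult_closed_def by (auto intro!: bexI[of _ 1] exI[of _ 1])

lemma mult_closed_adjoin:
  assumes "mult_closed U"
  shows "mult_closed (mult_adjoin U b)"
  unfolding mult_closed_def
proof (intro conjI ballI)
  show "1 \<in> mult_adjoin U b"
    using assms subset_mult_adjoin by (auto simp: mult_closed_def)
  fix x y assume "x \<in> mult_adjoin U b" "y \<in> mult_adjoin U b"
  then obtain u k u' k' where *: "x = u * b ^ k" "y = u' * b ^ k'" "u \<in> U" "u' \<in> U"
    unfolding mult_adjoin_def by blast
  then have "x * y = (u * u') * b ^ (k + k')" by (simp add: power_add algebra_simps)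
  then show "x * y \<in> mult_adjoin U b"
    using assms * unfolding mult_adjoin_def mult_closed_def by blast
qed

lemma prime_disjoint_mult_adjoin:
  assumes "prime_ideal_of UNIV P" "P \<inter> U = {}" "b \<notin> P"
  shows "P \<inter> mult_adjoin U b = {}"
  using assms prime_ideal_power by (fastforce simp: mult_adjoin_def prime_ideal_mult_iff)

lemma prime_compl_mult_closed: "prime_ideal_of UNIV P \<Longrightarrow> mult_closed (- P)"
  by (simp add: mult_closed_def prime_ideal_one prime_ideal_mult_iff)

text \<open>Zorn gives an ideal maximal among those that contain \<open>I\<close> and miss
  \<open>U\<close>; such an ideal is prime.\<close>

lemma exists_prime_avoiding:
  assumes I: "ideal_of UNIV I" and U: "mult_closed U" and disj: "I \<inter> U = {}"
  shows "\<exists>P. prime_ideal_of UNIV P \<and> I \<subseteq> P \<and> P \<inter> U = {}"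
proof -
  define A where "A = {K. ideal_of UNIV K \<and> I \<subseteq> K \<and> K \<inter> U = {}}"
  have "\<exists>M\<in>A. \<forall>X\<in>A. M \<subseteq> X \<longrightarrow> X = M"
  proof (rule subset_Zorn_nonempty)
    show "A \<noteq> {}" using I disj by (auto simp: A_def)
    fix C assume C: "C \<noteq> {}" "subset.chain A C"
    have CA: "C \<subseteq> A" using C by (simp add: subset_chain_def)
    have "ideal_of UNIV (\<Union>C)"
      unfolding ideal_of_UNIV_iff
    proof (intro conjI ballI allI)
      show "0 \<in> \<Union>C" using C CA by (auto simp: A_def ideal_of_UNIV_iff)
      fix x y assume "x \<in> \<Union>C" "y \<in> \<Union>C"
      then obtain K L where KL: "K \<in> C" "L \<in> C" "x \<in> K" "y \<in> L" by blast
      then have "K \<subseteq> L \<or> L \<subseteq> K" using C unfolding subset_chain_def by blast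
      then have "x + y \<in> K \<or> x + y \<in> L"
        using KL CA ideal_add unfolding A_def by blast
      then show "x + y \<in> \<Union>C" using KL by blast
    next
      fix r x assume "x \<in> \<Union>C"
      then show "r * x \<in> \<Union>C" using CA ideal_mult_left unfolding A_def by blast
    qed
    then show "\<Union>C \<in> A" using C CA unfolding A_def by blast
  qed
  then obtain M where M: "M \<in> A" and max: "\<And>X. X \<in> A \<Longrightarrow> M \<subseteq> X \<Longrightarrow> X = M" by blast
  have iM: "ideal_of UNIV M" and dM: "M \<inter> U = {}" and IM: "I \<subseteq> M" using M by (auto simp: A_def)
  \<comment> \<open>By maximality, adjoining an outside element makes the ideal meet
    \<open>U\<close>. Two outside elements with product in \<open>M\<close> would give two elements
    of \<open>U\<close> whose product lies in \<open>M\<close>.\<close>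
  have ext: "\<exists>r m. m \<in> M \<and> r * a + m \<in> U" if "a \<notin> M" for a
  proof -
    let ?J = "ideal_join 1 (\<lambda>_. a) M"
    have "?J \<notin> A"
      using max[of ?J] ideal_join_superset[of M 1 "\<lambda>_. a"] ideal_join_generator[OF iM, of 0 1 "\<lambda>_. a"] that
      by auto
    then obtain y where "y \<in> ?J" "y \<in> U"
      using ideal_join_ideal[OF iM, of 1 "\<lambda>_. a"] ideal_join_superset[of M 1 "\<lambda>_. a"] IM
      unfolding A_def by blast
    then show ?thesis unfolding ideal_join_single by blast
  qed
  have "prime_ideal_of UNIV M"
  proof (rule prime_idealI[OF iM])
    show "1 \<notin> M" using dM U by (auto simp: mult_closed_def)
    fix x y assume xy: "x * y \<in> M"
    show "x \<in> M \<or> y \<in> M"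
    proof (rule ccontr)
      assume "\<not> ?thesis"
      then obtain r m r' m' where *: "m \<in> M" "r * x + m \<in> U" "m' \<in> M" "r' * y + m' \<in> U"
        using ext by meson
      have "(r * x + m) * (r' * y + m') = (r * r') * (x * y) + (r * x * m' + (r' * y + m') * m)"
        by (simp add: algebra_simps)
      also have "\<dots> \<in> M" by (intro ideal_add[OF iM] ideal_mult_left[OF iM] * xy)
      finally show False using * U dM unfolding mult_closed_def by blast
    qed
  qed
  then show ?thesis using IM dM by blast
qed

section \<open>Chains of primes and Heitmann's lemma\<close>

text \<open>The spectrum of \<open>R/I\<close> with \<open>U\<close> inverted, seen inside the
  spectrum of \<open>R\<close>.\<close>

definition spec_on :: "'a::comm_ring_1 set \<Rightarrow> 'a set \<Rightarrow> 'a set set" where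
  "spec_on I U = {P. prime_ideal_of UNIV P \<and> I \<subseteq> P \<and> P \<inter> U = {}}"

definition chain_in :: "'a set set \<Rightarrow> nat \<Rightarrow> (nat \<Rightarrow> 'a set) \<Rightarrow> bool" where
  "chain_in X n f \<longleftrightarrow> (\<forall>i\<le>n. f i \<in> X) \<and> (\<forall>i<n. f i \<subset> f (Suc i))"

lemma krull_dim_ge_chain: "krull_dim_ge S n \<longleftrightarrow> (\<exists>f. chain_in {P. prime_ideal_of S P} n f)"
  by (simp add: krull_dim_ge_def chain_in_def)

lemma chain_in_mono: "chain_in X n f \<Longrightarrow> X \<subseteq> Y \<Longrightarrow> chain_in Y n f"
  by (auto simp: chain_in_def)

lemma chain_in_prepend:
  assumes "chain_in X n f" "Q \<in> X" "Q \<subset> f 0"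
  shows "chain_in X (Suc n) (case_nat Q f)"
  using assms by (auto simp: chain_in_def split: nat.splits)

lemma chain_in_append:
  assumes "chain_in X n f" "Q \<in> X" "f n \<subset> Q"
  shows "chain_in X (Suc n) (f(Suc n := Q))"
  using assms by (auto simp: chain_in_def le_Suc_eq less_Suc_eq)

text \<open>The recursion passes to the boundary of \<open>b n\<close>: the primes containing \<open>b n\<close> together with everything
  that multiplies it into all primes of the given set. A chain of such primes always extends downwards.\<close>

lemma heitmann:
  fixes b :: "nat \<Rightarrow> 'a::comm_ring_1"
  assumes U: "mult_closed U" and "ideal_of UNIV I" and "\<nexists>f. chain_in (spec_on I U) n f"
  shows "\<exists>x. \<forall>P\<in>spec_on I U. (\<forall>i<n. b i + a * x i \<in> P) \<longrightarrow> a \<in> P"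
  using assms(2,3)
proof (induction n arbitrary: I)
  \<comment> \<open>For \<open>n = 0\<close> even a chain with one member is excluded, so there are
    no primes to consider.\<close>
  case 0
  then have "P \<notin> spec_on I U" for P
    by (auto simp: chain_in_def dest: spec[of _ "\<lambda>_. P"])
  then show ?case by blast
next
  case (Suc n)
  define N where "N = {y. \<forall>P\<in>spec_on I U. y \<in> P}"
  have N: "ideal_of UNIV N"
    by (auto simp: N_def spec_on_def ideal_of_UNIV_iff prime_ideal_of_def)
  define K where "K = {z. z * b n \<in> N}"
  have K: "ideal_of UNIV K"
    using ideal_zero[OF N] ideal_add[OF N] ideal_mult_left[OF N] by (auto simp: K_def ideal_of_UNIV_iff distrib_right mult.assoc)
  define I' where "I' = ideal_join 1 (\<lambda>_. b n) K"
  have I': "ideal_of UNIV I'" and bI': "b n \<in> I'" and KI': "K \<subseteq> I'"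
    using ideal_join_ideal[OF K] ideal_join_generator[OF K, of 0 1 "\<lambda>_. b n"] ideal_join_superset[of K 1]
    unfolding I'_def by auto
  have NI': "N \<subseteq> K" by (auto simp: K_def intro: ideal_mult_right[OF N])
  have IN: "I \<subseteq> N" by (auto simp: N_def spec_on_def)
  have "\<nexists>f. chain_in (spec_on I' U) n f"
  proof
    assume "\<exists>f. chain_in (spec_on I' U) n f"
    then obtain f where f: "chain_in (spec_on I' U) n f" by blast
    then have f0: "f 0 \<in> spec_on I' U" by (simp add: chain_in_def)
    then have pf0: "prime_ideal_of UNIV (f 0)" and If0: "I' \<subseteq> f 0" and Uf0: "f 0 \<inter> U = {}"
      by (auto simp: spec_on_def)
    \<comment> \<open>A prime over \<open>N\<close> that misses \<open>?W\<close> lies in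
      \<open>f 0\<close> and omits \<open>b n \<in> f 0\<close>, so it is strictly smaller. If
      \<open>N\<close> met \<open>?W\<close>, some \<open>u \<notin> f 0\<close> would lie in
      \<open>K\<close>: a prime containing \<open>u * b n ^ k\<close> contains
      \<open>u * b n\<close>.\<close>
    let ?W = "mult_adjoin (- f 0) (b n)"
    have "N \<inter> ?W = {}"
    proof (rule ccontr)
      assume "N \<inter> ?W \<noteq> {}"
      then obtain u k where u: "u \<notin> f 0" "u * b n ^ k \<in> N"
        unfolding mult_adjoin_def by blast
      have "u * b n \<in> P" if "P \<in> spec_on I U" for P
        using u(2) that prime_ideal_power[of P "b n" k] by (auto simp: N_def spec_on_def prime_ideal_mult_iff)
      then have "u \<in> K" by (auto simp: K_def N_def)
      then show False using u KI' If0 by blast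
    qed
    then obtain Q where Q: "prime_ideal_of UNIV Q" "N \<subseteq> Q" "Q \<inter> ?W = {}"
      using exists_prime_avoiding[OF N mult_closed_adjoin[OF prime_compl_mult_closed[OF pf0]]] by blast
    have "Q \<subseteq> f 0" using Q(3) subset_mult_adjoin[of "- f 0" "b n"] by blast
    moreover have "b n \<notin> Q"
      using Q(3) mult_adjoin_self[OF prime_compl_mult_closed[OF pf0]] by blast
    ultimately have "Q \<subset> f 0" using bI' If0 by blast
    moreover have "Q \<in> spec_on I U"
      using Q \<open>Q \<subseteq> f 0\<close> Uf0 IN by (auto simp: spec_on_def)
    moreover have "chain_in (spec_on I U) n f"
      using IN NI' KI' by (intro chain_in_mono[OF f]) (auto simp: spec_on_def)
    ultimately show False using Suc.prems(2) chain_in_prepend by blast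
  qed
  then obtain x where x: "\<And>P. P \<in> spec_on I' U \<Longrightarrow> (\<And>i. i < n \<Longrightarrow> b i + a * x i \<in> P) \<Longrightarrow> a \<in> P"
    using Suc.IH[OF I'] by blast
  let ?g = "\<lambda>i. b i + a * x i"
  let ?J = "ideal_join n ?g I'"
  let ?V = "mult_adjoin U a"
  \<comment> \<open>By the induction hypothesis no prime over \<open>?J\<close> avoids both
    \<open>U\<close> and \<open>a\<close>, so \<open>?J\<close> contains some
    \<open>u * a ^ k\<close>.\<close>
  have "?J \<inter> ?V \<noteq> {}"
  proof
    assume "?J \<inter> ?V = {}"
    then obtain P where P: "prime_ideal_of UNIV P" "?J \<subseteq> P" "P \<inter> ?V = {}"
      using exists_prime_avoiding[OF ideal_join_ideal[OF I'] mult_closed_adjoin[OF U]] by blast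
    have "P \<inter> U = {}" using P(3) subset_mult_adjoin[of U a] by blast
    moreover have "a \<notin> P" using P(3) mult_adjoin_self[OF U] by blast
    moreover have "I' \<subseteq> P" "\<And>i. i < n \<Longrightarrow> ?g i \<in> P"
      using P(2) ideal_join_superset[of I' n ?g] ideal_join_generator[OF I', of _ n ?g] by blast+
    ultimately show False using x[of P] P by (auto simp: spec_on_def)
  qed
  then obtain y where "y \<in> ?J" "y \<in> ?V" by blast
  then obtain u k c z' where "u \<in> U" "y = u * a ^ k" "y = (\<Sum>i<n. c i * ?g i) + z'" "z' \<in> I'"
    unfolding ideal_join_def mult_adjoin_def by blast
  then have u: "u \<in> U" "u * a ^ k = (\<Sum>i<n. c i * ?g i) + z'" "z' \<in> I'" by simp_all
  then obtain r z where z: "z' = r * b n + z" "z \<in> K"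
    unfolding I'_def ideal_join_single by blast
  show ?case
  \<comment> \<open>The last coefficient is the \<open>K\<close>-part \<open>z\<close> of that
    relation. As \<open>z * b n\<close> lies in every prime considered,
    \<open>b n + a * z \<in> P\<close> forces both \<open>b n\<close> and \<open>a * z\<close> into
    \<open>P\<close>; if \<open>z \<in> P\<close>, the relation puts \<open>u * a ^ k\<close> into
    \<open>P\<close>.\<close>
  proof (intro exI[of _ "x(n := z)"] ballI impI)
    fix P assume P: "P \<in> spec_on I U" and g: "\<forall>i<Suc n. b i + a * (x(n := z)) i \<in> P"
    have pP: "prime_ideal_of UNIV P" and UP: "P \<inter> U = {}" using P by (auto simp: spec_on_def)
    note iP = prime_ideal_ideal[OF pP]
    have gi: "?g i \<in> P" if "i < n" for i using g that by (metis fun_upd_apply less_SucI less_irrefl)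
    have gn: "b n + a * z \<in> P" using g by (metis fun_upd_same lessI)
    have "z * b n \<in> P" using z P by (auto simp: K_def N_def)
    then have "z \<in> P \<or> b n \<in> P" using pP by (simp add: prime_ideal_mult_iff)
    then have bP: "b n \<in> P"
      using gn ideal_add_cancel[OF iP, of "a * z" "b n"] ideal_mult_left[OF iP] by blast
    then have "a * z \<in> P" using gn ideal_add_cancel[OF iP bP, of "a * z"] by (simp add: add.commute)
    then consider "a \<in> P" | "z \<in> P" using pP by (auto simp: prime_ideal_mult_iff)
    then show "a \<in> P"
    proof cases
      case 2
      moreover have "(\<Sum>i<n. c i * ?g i) \<in> P"
        using gi by (intro ideal_sum[OF iP] ideal_mult_left[OF iP]) simp
      ultimately have "u * a ^ k \<in> P"
        unfolding u z by (intro ideal_add[OF iP] ideal_mult_left[OF iP] bP)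
      then show ?thesis
        using UP u(1) pP prime_ideal_power by (auto simp only: prime_ideal_mult_iff)
    qed
  qed
qed

section \<open>Matrices up to a scalar\<close>

definition mmul :: "nat \<Rightarrow> (nat \<Rightarrow> nat \<Rightarrow> 'a::comm_ring_1) \<Rightarrow> (nat \<Rightarrow> nat \<Rightarrow> 'a) \<Rightarrow> nat \<Rightarrow> nat \<Rightarrow> 'a" where
  "mmul n A B = (\<lambda>i j. \<Sum>k<n. A i k * B k j)"

definition mutual_inverse :: "nat \<Rightarrow> 'a::comm_ring_1 \<Rightarrow> (nat \<Rightarrow> nat \<Rightarrow> 'a) \<Rightarrow> (nat \<Rightarrow> nat \<Rightarrow> 'a) \<Rightarrow> bool" where
  "mutual_inverse n u A B \<longleftrightarrow> (\<forall>i<n. \<forall>j<n. mmul n A B i j = u * idm i j \<and> mmul n B A i j = u * idm i j)"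

lemma mutual_inverse_commute: "mutual_inverse n u A B \<longleftrightarrow> mutual_inverse n u B A"
  by (auto simp: mutual_inverse_def)

lemma GL_iff: "A \<in> GL n \<longleftrightarrow> (\<exists>B. mutual_inverse n 1 A B)"
  by (simp add: GL_def mutual_inverse_def mmul_def)

lemma mmul_assoc: "mmul n (mmul n A B) C = mmul n A (mmul n B C)"
  unfolding mmul_def
  by (subst sum_distrib_right, subst sum_distrib_left, intro ext, subst sum.swap) (simp add: mult.assoc)

lemma row_mult_mmul: "row_mult n (row_mult n v A) B = row_mult n v (mmul n A B)"
  unfolding mmul_def row_mult_def
  by (subst sum_distrib_right, subst sum_distrib_left, intro ext, subst sum.swap) (simp add: mult.assoc)

lemma mmul_cong:
  "(\<And>k. k < n \<Longrightarrow> A i k = A' i k) \<Longrightarrow> (\<And>k. k < n \<Longrightarrow> B k j = B' k j) \<Longrightarrow> mmul n A B i j = mmul n A' B' i j"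
  by (simp add: mmul_def)

lemma row_mult_cong:
  "(\<And>k. k < n \<Longrightarrow> v k = w k) \<Longrightarrow> (\<And>k. k < n \<Longrightarrow> B k j = B' k j) \<Longrightarrow> row_mult n v B j = row_mult n w B' j"
  by (simp add: row_mult_def)

lemma mmul_scalar_left: "i < n \<Longrightarrow> mmul n (\<lambda>i j. u * idm i j) A i j = u * A i j"
  by (simp add: mmul_def idm_def if_distrib[of "\<lambda>x. x * _"] if_distrib[of "\<lambda>x. _ * x"] cong: if_cong)

lemma row_mult_scalar: "j < n \<Longrightarrow> row_mult n v (\<lambda>i j. u * idm i j) j = u * v j"
  by (simp add: row_mult_def idm_def if_distrib cong: if_cong)

lemma mutual_inverse_mmul:
  assumes "mutual_inverse n u A B" "mutual_inverse n u' A' B'"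
  shows "mutual_inverse n (u * u') (mmul n A A') (mmul n B' B)"
proof -
  have *: "mmul n (mmul n A A') (mmul n B' B) i j = (u * u') * idm i j"
    if "mutual_inverse n u A B" "mutual_inverse n u' A' B'" "i < n" "j < n"
    for u u' :: 'a and A B A' B' i j
  proof -
    have "mmul n (mmul n A A') (mmul n B' B) i j = mmul n A (mmul n (mmul n A' B') B) i j"
      by (simp add: mmul_assoc)
    also have "\<dots> = mmul n A (mmul n (\<lambda>i j. u' * idm i j) B) i j"
      using that by (intro mmul_cong refl) (auto simp: mutual_inverse_def)
    also have "\<dots> = mmul n A (\<lambda>i j. u' * B i j) i j"
      by (intro mmul_cong refl) (simp add: mmul_scalar_left)
    also have "\<dots> = u' * mmul n A B i j"
      by (simp add: mmul_def sum_distrib_left algebra_simps)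
    also have "\<dots> = (u * u') * idm i j"
      using that by (simp add: mutual_inverse_def algebra_simps)
    finally show ?thesis .
  qed
  show ?thesis
    unfolding mutual_inverse_def
    using *[OF assms] *[of u' B' A' u B A] assms by (auto simp: mutual_inverse_commute mult.commute)
qed

text \<open>For \<open>U = {1}\<close> this is equivalence under invertible matrices over the ring
  itself; in general the matrix becomes invertible once \<open>U\<close> is inverted.\<close>

definition row_equiv :: "nat \<Rightarrow> 'a::comm_ring_1 set \<Rightarrow> (nat \<Rightarrow> 'a) \<Rightarrow> (nat \<Rightarrow> 'a) \<Rightarrow> bool" where
  "row_equiv n U v w \<longleftrightarrow> (\<exists>M B. \<exists>u\<in>U. mutual_inverse n u M B \<and> (\<forall>j<n. row_mult n v M j = w j))"

lemma row_equiv_trans: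
  assumes U: "mult_closed U" and "row_equiv n U v w" "row_equiv n U w x"
  shows "row_equiv n U v x"
proof -
  obtain M B u where M: "u \<in> U" "mutual_inverse n u M B" "\<And>j. j < n \<Longrightarrow> row_mult n v M j = w j"
    using assms(2) unfolding row_equiv_def by blast
  obtain M' B' u' where M': "u' \<in> U" "mutual_inverse n u' M' B'" "\<And>j. j < n \<Longrightarrow> row_mult n w M' j = x j"
    using assms(3) unfolding row_equiv_def by blast
  have "row_mult n v (mmul n M M') j = x j" if "j < n" for j
  proof -
    have "row_mult n v (mmul n M M') j = row_mult n (row_mult n v M) M' j" by (simp add: row_mult_mmul)
    also have "\<dots> = row_mult n w M' j" by (intro row_mult_cong M refl)
    finally show ?thesis using M'(3)[OF that] by simp
  qed
  then show ?thesis
    using mutual_inverse_mmul[OF M(2) M'(2)] M(1) M'(1) U unfolding row_equiv_def mult_closed_def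
    by blast
qed

section \<open>Elementary operations as identity plus a square-zero matrix\<close>

lemma mutual_inverse_nilpotent:
  assumes "\<And>i j. i < n \<Longrightarrow> j < n \<Longrightarrow> mmul n N N i j = 0"
  shows "mutual_inverse n 1 (\<lambda>i j. idm i j + N i j) (\<lambda>i j. idm i j - N i j)"
  using assms
  by (simp add: mutual_inverse_def mmul_def distrib_left distrib_right left_diff_distrib right_diff_distrib
      sum.distrib sum_subtractf idm_def if_distrib[of "\<lambda>x. x * _"] if_distrib[of "\<lambda>x. _ * x"] cong: if_cong)

lemma row_mult_nilpotent:
  "j < n \<Longrightarrow> row_mult n v (\<lambda>i j. idm i j + N i j) j = v j + row_mult n v N j"
  by (simp add: row_mult_def distrib_left sum.distrib idm_def if_distrib[of "\<lambda>x. _ * x"] cong: if_cong)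

text \<open>Added to the identity, this adds a combination of the later entries of a row to its
  first entry. Its companion \<open>row_op\<close> adds multiples of the first entry to all later
  ones at once.\<close>

definition col_op :: "(nat \<Rightarrow> 'a::comm_ring_1) \<Rightarrow> nat \<Rightarrow> nat \<Rightarrow> 'a" where
  "col_op c = (\<lambda>i j. case i of 0 \<Rightarrow> 0 | Suc i \<Rightarrow> if j = 0 then c i else 0)"

definition row_op :: "(nat \<Rightarrow> 'a::comm_ring_1) \<Rightarrow> nat \<Rightarrow> nat \<Rightarrow> 'a" where
  "row_op x = (\<lambda>i j. case j of 0 \<Rightarrow> 0 | Suc j \<Rightarrow> if i = 0 then x j else 0)"

lemma col_op_square: "mmul n (col_op c) (col_op c') i j = 0"
  by (auto simp: mmul_def col_op_def intro!: sum.neutral split: nat.splits)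

lemma row_op_square: "mmul n (row_op c) (row_op c') i j = 0"
  by (auto simp: mmul_def row_op_def intro!: sum.neutral split: nat.splits)

lemma row_mult_col_op: "row_mult (Suc d) v (col_op c) j = (if j = 0 then \<Sum>i<d. c i * v (Suc i) else 0)"
  by (simp add: row_mult_def col_op_def sum.lessThan_Suc_shift mult.commute del: sum.lessThan_Suc)

lemma row_mult_row_op: "row_mult (Suc d) v (row_op x) j = (case j of 0 \<Rightarrow> 0 | Suc j \<Rightarrow> v 0 * x j)"
  by (simp add: row_mult_def row_op_def sum.lessThan_Suc_shift del: sum.lessThan_Suc split: nat.splits)

lemma row_equiv_nilpotent:
  assumes "1 \<in> U" "\<And>i j. i < n \<Longrightarrow> j < n \<Longrightarrow> mmul n N N i j = 0"
    and "\<And>j. j < n \<Longrightarrow> w j = v j + row_mult n v N j"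
  shows "row_equiv n U v w"
  unfolding row_equiv_def using mutual_inverse_nilpotent[OF assms(2)] assms(1,3)
  by (intro exI bexI[of _ 1] conjI) (auto simp: row_mult_nilpotent)

lemma row_equiv_col_op:
  assumes "1 \<in> U" "a' = a + (\<Sum>i<d. c i * b i)"
  shows "row_equiv (Suc d) U (case_nat a b) (case_nat a' b)"
  by (rule row_equiv_nilpotent[OF assms(1), of _ "col_op c"])
    (auto simp: col_op_square row_mult_col_op assms(2) split: nat.splits)

lemma row_equiv_row_op:
  assumes "1 \<in> U" "\<And>i. i < d \<Longrightarrow> b' i = b i + a * x i"
  shows "row_equiv (Suc d) U (case_nat a b) (case_nat a b')"
  by (rule row_equiv_nilpotent[OF assms(1), of _ "row_op x"])
    (auto simp: row_op_square row_mult_row_op assms(2) split: nat.splits)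

text \<open>Two complementary diagonal matrices, with \<open>u\<close> on \<open>S\<close> and with
  \<open>u\<close> off \<open>S\<close>, multiply to the scalar \<open>u\<close>.\<close>

lemma row_equiv_scale:
  assumes "u \<in> U"
  shows "row_equiv n U v (\<lambda>j. if j \<in> S then u * v j else v j)"
  unfolding row_equiv_def
proof (intro exI bexI[OF _ assms] conjI allI impI)
  let ?M = "\<lambda>i j. (if j \<in> S then u else 1) * idm i j" and ?B = "\<lambda>i j. (if j \<in> S then 1 else u) * idm i j"
  show "mutual_inverse n u ?M ?B"
    by (auto simp: mutual_inverse_def mmul_def idm_def if_distrib[of "\<lambda>x. x * _"] if_distrib[of "\<lambda>x. _ * x"] cong: if_cong)
  show "row_mult n v ?M j = (if j \<in> S then u * v j else v j)" if "j < n" for j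
    using that by (simp add: row_mult_def idm_def if_distrib[of "\<lambda>x. _ * x"] cong: if_cong)
qed

section \<open>The local step\<close>

lemma unimodular_not_in_prime:
  assumes "unimodular (Suc d) v" "prime_ideal_of UNIV P" "v 0 \<in> P"
  shows "\<exists>i<d. v (Suc i) \<notin> P"
proof (rule ccontr)
  note iP = prime_ideal_ideal[OF assms(2)]
  assume "\<not> ?thesis"
  then have "v i * w i \<in> P" if "i < Suc d" for i w
    using that assms(3) ideal_mult_right[OF iP] by (cases i) auto
  then have "(\<Sum>i<Suc d. v i * w i) \<in> P" for w by (intro ideal_sum[OF iP]) auto
  then show False using assms(1) prime_ideal_one[OF assms(2)] unfolding unimodular_def by metis
qed

text \<open>The later entries are first corrected where \<open>s\<close> vanishes and then where it
  does not. In between, the first entry is traded for a multiple of \<open>s\<close>, so that the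
  second correction does not spoil the first.\<close>

lemma local_reduction:
  fixes v :: "nat \<Rightarrow> 'a::comm_ring_1"
  assumes U: "mult_closed U"
    and closed: "\<nexists>f. chain_in (spec_on {r * s | r. True} U) d f"
    and "open": "\<nexists>f. chain_in (spec_on {0} (mult_adjoin U s)) d f"
    and v: "unimodular (Suc d) v"
  shows "\<exists>u\<in>U. row_equiv (Suc d) U v (case_nat u (\<lambda>_. 0))"
proof -
  have one: "1 \<in> U" using U by (simp add: mult_closed_def)
  define a b where "a = v 0" and "b = (\<lambda>i. v (Suc i))"
  have vab: "v = case_nat a b" by (auto simp: a_def b_def split: nat.splits)
  have proper: "\<exists>i<d. b i \<notin> P" if "prime_ideal_of UNIV P" "a \<in> P" for P
    using unimodular_not_in_prime[OF v that(1)] that(2) by (simp add: a_def b_def)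
  have zero: "ideal_of UNIV {0::'a}" by (simp add: ideal_of_UNIV_iff)
  define sR where "sR = {r * s | r. True}"
  have sR: "ideal_of UNIV sR"
    unfolding ideal_of_UNIV_iff sR_def
    by (auto intro: exI[of _ 0] simp: distrib_right[symmetric] mult.assoc[symmetric])
  have s: "s \<in> sR" unfolding sR_def by (metis (mono_tags, lifting) mem_Collect_eq mult_1)
  obtain x where x: "\<And>P. P \<in> spec_on sR U \<Longrightarrow> (\<And>i. i < d \<Longrightarrow> b i + a * x i \<in> P) \<Longrightarrow> a \<in> P"
    using heitmann[OF U sR, of d b a] closed unfolding sR_def by blast
  define b1 where "b1 = (\<lambda>i. b i + a * x i)"
  have b_in: "b i \<in> P" if "prime_ideal_of UNIV P" "b1 i \<in> P" "a \<in> P" for P i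
    using that ideal_add_cancel[OF prime_ideal_ideal[OF that(1)], of "a * x i" "b i"]
    by (simp add: b1_def prime_ideal_mult_iff)
  \<comment> \<open>A prime over \<open>s\<close> and all \<open>b1 i\<close> that misses
    \<open>U\<close> would contain \<open>a\<close> by the choice of \<open>x\<close>, hence every
    entry of \<open>v\<close>.\<close>
  have "ideal_join d b1 sR \<inter> U \<noteq> {}"
  proof
    assume "ideal_join d b1 sR \<inter> U = {}"
    then obtain P where P: "prime_ideal_of UNIV P" "ideal_join d b1 sR \<subseteq> P" "P \<inter> U = {}"
      using exists_prime_avoiding[OF ideal_join_ideal[OF sR] U] by blast
    have b1P: "b1 i \<in> P" if "i < d" for i using ideal_join_generator[OF sR that] P(2) by blast
    then have "a \<in> P"
      using x[of P] P ideal_join_superset[of sR d b1] by (auto simp: spec_on_def b1_def)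
    then show False using proper[OF P(1)] b_in[OF P(1)] b1P by blast
  qed
  then obtain u c t where u: "u \<in> U" "u = (\<Sum>i<d. c i * b1 i) + t * s"
    unfolding ideal_join_def sR_def by blast
  \<comment> \<open>Modulo the \<open>b1 i\<close>, the entry \<open>u * a\<close> equals
    \<open>w\<close>, which vanishes wherever \<open>s\<close> does.\<close>
  define w where "w = t * s * a"
  have w: "w = u * a + (\<Sum>i<d. (- c i * a) * b1 i)"
    by (simp add: w_def u(2) algebra_simps sum_distrib_left sum_negf)
  obtain y where y: "\<And>P. P \<in> spec_on {0} (mult_adjoin U s) \<Longrightarrow> (\<And>i. i < d \<Longrightarrow> b1 i + w * y i \<in> P) \<Longrightarrow> w \<in> P"
    using heitmann[OF mult_closed_adjoin[OF U] zero, of s d b1 w] "open" by blast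
  define b2 where "b2 = (\<lambda>i. b1 i + w * y i)"
  have b1_in: "b1 i \<in> P" if "prime_ideal_of UNIV P" "b2 i \<in> P" "w \<in> P" for P i
    using that ideal_add_cancel[OF prime_ideal_ideal[OF that(1)], of "w * y i" "b1 i"]
    by (simp add: b2_def prime_ideal_mult_iff)
  \<comment> \<open>A prime over all \<open>b2 i\<close> that misses \<open>U\<close> contains
    \<open>w\<close>: by divisibility if it contains \<open>s\<close>, by the choice of
    \<open>y\<close> otherwise. Hence it contains all \<open>b1 i\<close>, then
    \<open>u * a\<close>, then \<open>a\<close>, and so the whole row.\<close>
  have "ideal_join d b2 {0} \<inter> U \<noteq> {}"
  proof
    assume "ideal_join d b2 {0} \<inter> U = {}"
    then obtain P where P: "prime_ideal_of UNIV P" "ideal_join d b2 {0} \<subseteq> P" "P \<inter> U = {}"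
      using exists_prime_avoiding[OF ideal_join_ideal[OF zero] U] by blast
    note iP = prime_ideal_ideal[OF P(1)]
    have b2P: "b2 i \<in> P" if "i < d" for i using ideal_join_generator[OF zero that] P(2) by blast
    have wP: "w \<in> P"
    proof (cases "s \<in> P")
      case True
      then show ?thesis using P(1) by (simp add: w_def prime_ideal_mult_iff)
    next
      case False
      then have "P \<in> spec_on {0} (mult_adjoin U s)"
        using prime_disjoint_mult_adjoin[OF P(1,3)] P(1) ideal_zero[OF iP] by (simp add: spec_on_def)
      then show ?thesis using y b2P by (auto simp: b2_def)
    qed
    have b1P: "b1 i \<in> P" if "i < d" for i using b1_in[OF P(1) b2P wP] that .
    have sumP: "(\<Sum>i<d. f i * b1 i) \<in> P" for f
      using b1P by (intro ideal_sum[OF iP] ideal_mult_left[OF iP]) auto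
    have "s \<notin> P"
      using u P(3) ideal_add[OF iP sumP ideal_mult_left[OF iP]] by blast
    moreover have "u * a \<in> P" using wP sumP[of "\<lambda>i. - c i * a"] ideal_add_cancel[OF iP] unfolding w by blast
    then have "a \<in> P" using u(1) P by (auto simp: prime_ideal_mult_iff)
    ultimately show False using proper[OF P(1)] b_in[OF P(1)] b1P by blast
  qed
  then obtain u' c' where u': "u' \<in> U" "u' = (\<Sum>i<d. c' i * b2 i)"
    unfolding ideal_join_def by auto
  \<comment> \<open>The first entry is to change from \<open>u' * w\<close> to \<open>u'\<close>;
    the difference is a combination of the \<open>b2 i\<close>.\<close>
  have "(\<Sum>i<d. ((1 - w) * c' i) * b2 i) = (1 - w) * u'"
    by (simp add: u'(2) sum_distrib_left mult.assoc)
  then have u'w: "u' = u' * w + (\<Sum>i<d. ((1 - w) * c' i) * b2 i)" by (simp add: algebra_simps)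
  note [trans] = row_equiv_trans[OF U]
  have scale0: "row_equiv (Suc d) U (case_nat p q) (case_nat (e * p) q)" if "e \<in> U" for p q e
    using row_equiv_scale[OF that, of "Suc d" "case_nat p q" "{0}"]
    by (rule back_subst[of "row_equiv _ _ _"]) (auto split: nat.splits)
  have scale1: "row_equiv (Suc d) U (case_nat p q) (case_nat p (\<lambda>i. e * q i))" if "e \<in> U" for p q e
    using row_equiv_scale[OF that, of "Suc d" "case_nat p q" "{0<..}"]
    by (rule back_subst[of "row_equiv _ _ _"]) (auto split: nat.splits)
  have "row_equiv (Suc d) U v (case_nat a b1)"
    unfolding vab by (rule row_equiv_row_op[OF one]) (simp add: b1_def)
  also have "row_equiv (Suc d) U (case_nat a b1) (case_nat (u * a) b1)"
    by (rule scale0[OF u(1)])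
  also have "row_equiv (Suc d) U (case_nat (u * a) b1) (case_nat w b1)"
    by (rule row_equiv_col_op[OF one w])
  also have "row_equiv (Suc d) U (case_nat w b1) (case_nat w b2)"
    by (rule row_equiv_row_op[OF one]) (simp add: b2_def)
  also have "row_equiv (Suc d) U (case_nat w b2) (case_nat (u' * w) b2)"
    by (rule scale0[OF u'(1)])
  also have "row_equiv (Suc d) U (case_nat (u' * w) b2) (case_nat u' b2)"
    by (rule row_equiv_col_op[OF one u'w])
  \<comment> \<open>After this scaling the later entries are multiples of the first one and can be
    cleared without division.\<close>
  also have "row_equiv (Suc d) U (case_nat u' b2) (case_nat u' (\<lambda>i. u' * b2 i))"
    by (rule scale1[OF u'(1)])
  also have "row_equiv (Suc d) U (case_nat u' (\<lambda>i. u' * b2 i)) (case_nat u' (\<lambda>_. 0))"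
    by (rule row_equiv_row_op[OF one, of _ _ _ _ "\<lambda>i. - b2 i"]) simp
  finally show ?thesis using u'(1) by blast
qed

section \<open>Leading and trailing coefficients modulo a prime\<close>

text \<open>The degree of \<open>f\<close> modulo \<open>P\<close>, as a relation because it fails
  to exist when \<open>f\<close> vanishes modulo \<open>P\<close>. In the same way
  \<open>bot_at\<close> is the order.\<close>

definition top_at :: "'a::comm_ring_1 set \<Rightarrow> 'a poly \<Rightarrow> nat \<Rightarrow> bool" where
  "top_at P f i \<longleftrightarrow> coeff f i \<notin> P \<and> (\<forall>k>i. coeff f k \<in> P)"

definition bot_at :: "'a::comm_ring_1 set \<Rightarrow> 'a poly \<Rightarrow> nat \<Rightarrow> bool" where
  "bot_at P f i \<longleftrightarrow> coeff f i \<notin> P \<and> (\<forall>k<i. coeff f k \<in> P)"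

lemma top_at_exists:
  assumes "0 \<in> P" "coeff f i \<notin> P"
  shows "\<exists>j. top_at P f j"
proof -
  let ?S = "{i. coeff f i \<notin> P}"
  have "?S \<subseteq> {..degree f}" using assms(1) by (auto intro: le_degree)
  then have fin: "finite ?S" using finite_subset by blast
  then have "Max ?S \<in> ?S" using assms(2) by (intro Max_in) auto
  moreover have "coeff f k \<in> P" if "k > Max ?S" for k using Max_ge[OF fin, of k] that by auto
  ultimately have "top_at P f (Max ?S)" unfolding top_at_def by blast
  then show ?thesis by blast
qed

lemma bot_at_exists:
  assumes "coeff f i \<notin> P"
  shows "\<exists>j. bot_at P f j"
proof -
  have "bot_at P f (LEAST i. coeff f i \<notin> P)"
    using LeastI[of "\<lambda>i. coeff f i \<notin> P", OF assms] not_less_Least[of _ "\<lambda>i. coeff f i \<notin> P"]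
    unfolding bot_at_def by blast
  then show ?thesis by blast
qed

lemma top_at_unique: "top_at P f i \<Longrightarrow> top_at P f j \<Longrightarrow> i = j"
  unfolding top_at_def by (metis linorder_neqE_nat)

lemma bot_at_unique: "bot_at P f i \<Longrightarrow> bot_at P f j \<Longrightarrow> i = j"
  unfolding bot_at_def by (metis linorder_neqE_nat)

lemma bot_le_top: "bot_at P f i \<Longrightarrow> top_at P f j \<Longrightarrow> i \<le> j"
  unfolding bot_at_def top_at_def by (metis not_le_imp_less)

lemma coeff_mult_notin_prime:
  assumes P: "prime_ideal_of UNIV P" and "coeff f i \<notin> P" "coeff g j \<notin> P"
    and rest: "\<And>k. k \<le> i + j \<Longrightarrow> k \<noteq> i \<Longrightarrow> coeff f k \<in> P \<or> coeff g (i + j - k) \<in> P"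
  shows "coeff (f * g) (i + j) \<notin> P"
proof
  note iP = prime_ideal_ideal[OF P]
  assume "coeff (f * g) (i + j) \<in> P"
  moreover have "coeff (f * g) (i + j) =
      coeff f i * coeff g j + (\<Sum>k\<in>{..i + j} - {i}. coeff f k * coeff g (i + j - k))"
    unfolding coeff_mult by (subst sum.remove[of _ i]) auto
  moreover have "(\<Sum>k\<in>{..i + j} - {i}. coeff f k * coeff g (i + j - k)) \<in> P"
    using rest by (intro ideal_sum[OF iP]) (auto simp: prime_ideal_mult_iff[OF P])
  ultimately show False
    using ideal_add_cancel[OF iP] assms by (simp add: prime_ideal_mult_iff[OF P])
qed

lemma coeff_mult_in_prime:
  assumes P: "prime_ideal_of UNIV P"
    and "\<And>k. k \<le> n \<Longrightarrow> coeff f k \<in> P \<or> coeff g (n - k) \<in> P"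
  shows "coeff (f * g) n \<in> P"
  unfolding coeff_mult using assms(2)
  by (intro ideal_sum[OF prime_ideal_ideal[OF P]]) (auto simp: prime_ideal_mult_iff[OF P])

lemma top_at_mult:
  assumes P: "prime_ideal_of UNIV P" and f: "top_at P f i" and g: "top_at P g j"
  shows "top_at P (f * g) (i + j)"
  unfolding top_at_def
proof (intro conjI allI impI)
  have *: "coeff f k \<in> P \<or> coeff g (n - k) \<in> P" if "k > i \<or> n - k > j" for n k
    using that f g by (auto simp: top_at_def)
  show "coeff (f * g) (i + j) \<notin> P"
    using f g by (intro coeff_mult_notin_prime[OF P] *) (auto simp: top_at_def)
  show "coeff (f * g) n \<in> P" if "n > i + j" for n
    using that by (intro coeff_mult_in_prime[OF P] *) auto
qed

lemma bot_at_mult: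
  assumes P: "prime_ideal_of UNIV P" and f: "bot_at P f i" and g: "bot_at P g j"
  shows "bot_at P (f * g) (i + j)"
  unfolding bot_at_def
proof (intro conjI allI impI)
  have *: "coeff f k \<in> P \<or> coeff g (n - k) \<in> P" if "k < i \<or> n - k < j" for n k
    using that f g by (auto simp: bot_at_def)
  show "coeff (f * g) (i + j) \<notin> P"
    using f g by (intro coeff_mult_notin_prime[OF P] *) (auto simp: bot_at_def)
  show "coeff (f * g) n \<in> P" if "n < i + j" for n
    using that by (intro coeff_mult_in_prime[OF P] *) auto
qed

text \<open>Degree minus order modulo \<open>P\<close>, the Euclidean size of a Laurent polynomial.
  It is meaningful only if some coefficient lies outside \<open>P\<close>.\<close>

definition width :: "'a::comm_ring_1 set \<Rightarrow> 'a poly \<Rightarrow> nat" where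
  "width P f = (THE j. top_at P f j) - (THE i. bot_at P f i)"

lemma width_eq: "bot_at P f i \<Longrightarrow> top_at P f j \<Longrightarrow> width P f = j - i"
  unfolding width_def by (metis bot_at_unique the_equality top_at_unique)

lemma width_mult:
  assumes P: "prime_ideal_of UNIV P" and "coeff f i \<notin> P" "coeff g j \<notin> P"
  shows "width P (f * g) = width P f + width P g"
proof -
  note z = ideal_zero[OF prime_ideal_ideal[OF P]]
  obtain t b t' b' where *: "top_at P f t" "bot_at P f b" "top_at P g t'" "bot_at P g b'"
    by (metis top_at_exists[OF z] bot_at_exists assms(2,3))
  then show ?thesis
    using width_eq[OF *(2,1)] width_eq[OF *(4,3)] width_eq[OF bot_at_mult[OF P *(2,4)] top_at_mult[OF P *(1,3)]]
      bot_le_top[OF *(2,1)] bot_le_top[OF *(4,3)] by simp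
qed

text \<open>One step of pseudo-division. Cross-multiplying cancels the leading terms at
  \<open>i + j\<close>; since \<open>f\<close> is no wider than \<open>g\<close>, nothing appears
  below the bottom of the shifted \<open>g\<close>. The monomials have the shape that
  \<open>theta\<close> gives to homogeneous elements.\<close>

lemma width_pseudo_remainder:
  assumes P: "prime_ideal_of UNIV P" and f: "top_at P f i" and g: "top_at P g j"
    and le: "width P f \<le> width P g"
    and h: "h = monom (coeff f i) i * g - monom (coeff g j) j * f" "coeff h k \<notin> P"
  shows "width P h < width P g"
proof -
  note iP = prime_ideal_ideal[OF P]
  obtain f0 where f0: "bot_at P f f0" using f bot_at_exists by (metis top_at_def)
  obtain g0 where g0: "bot_at P g g0" using g bot_at_exists by (metis top_at_def)
  have lo: "i + g0 \<le> j + f0"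
    using le width_eq[OF f0 f] width_eq[OF g0 g] bot_le_top[OF f0 f] bot_le_top[OF g0 g] by simp
  have coeff_h: "coeff h n = (if n < i then 0 else coeff f i * coeff g (n - i))
      - (if n < j then 0 else coeff g j * coeff f (n - j))" for n
    by (simp add: h(1) coeff_monom_mult not_less)
  have up: "coeff h n \<in> P" if "n \<ge> i + j" for n
  proof (cases "n = i + j")
    case True
    then show ?thesis using ideal_zero[OF iP] by (simp add: coeff_h mult.commute)
  next
    case False
    then have "coeff g (n - i) \<in> P" "coeff f (n - j) \<in> P"
      using that f g by (auto simp: top_at_def)
    then show ?thesis
      using that unfolding coeff_h by (auto intro!: ideal_diff[OF iP] ideal_mult_left[OF iP])
  qed
  have dn: "coeff h n \<in> P" if "n < i + g0" for n
  proof -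
    have "n \<ge> i \<Longrightarrow> coeff g (n - i) \<in> P" "n \<ge> j \<Longrightarrow> coeff f (n - j) \<in> P"
      using that lo f0 g0 by (auto simp: bot_at_def)
    then have "(if n < i then 0 else coeff f i * coeff g (n - i)) \<in> P"
      "(if n < j then 0 else coeff g j * coeff f (n - j)) \<in> P"
      by (auto intro: ideal_mult_left[OF iP] ideal_zero[OF iP])
    then show ?thesis unfolding coeff_h by (rule ideal_diff[OF iP])
  qed
  obtain t b where tb: "top_at P h t" "bot_at P h b"
    by (metis top_at_exists[OF ideal_zero[OF iP]] bot_at_exists h(2))
  then have "t < i + j" "b \<ge> i + g0" "b \<le> t"
    using up dn bot_le_top by (auto simp: top_at_def bot_at_def not_less[symmetric])
  then show ?thesis using width_eq[OF tb(2,1)] width_eq[OF g0 g] by simp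
qed

section \<open>Graded domains\<close>

locale graded_domain =
  fixes Rg :: "nat \<Rightarrow> 'a::idom set"
  assumes graded: "graded_ring Rg"
begin

lemma homog_zero: "0 \<in> Rg i"
  and homog_add: "x \<in> Rg i \<Longrightarrow> y \<in> Rg i \<Longrightarrow> x + y \<in> Rg i"
  and homog_uminus: "x \<in> Rg i \<Longrightarrow> - x \<in> Rg i"
  and homog_mult: "x \<in> Rg i \<Longrightarrow> y \<in> Rg j \<Longrightarrow> x * y \<in> Rg (i + j)"
  and nontrivial: "\<exists>i\<ge>1. Rg i \<noteq> {0}"
  using graded unfolding graded_ring_def by (elim conjE, simp)+

lemma decomposition:
  "\<exists>!f. (\<forall>i. f i \<in> Rg i) \<and> finite {i. f i \<noteq> 0} \<and> x = (\<Sum>i\<in>{i. f i \<noteq> 0}. f i)"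
  using graded unfolding graded_ring_def by (elim conjE) (erule spec)

lemma homog_sum: "(\<And>k. k \<in> A \<Longrightarrow> f k \<in> Rg i) \<Longrightarrow> sum f A \<in> Rg i"
  by (induction A rule: infinite_finite_induct) (auto simp: homog_zero homog_add)

text \<open>The homotopy \<open>x \<mapsto> \<Sum> x\<^sub>i T\<^sup>i\<close>; its value at \<open>0\<close> is the degree zero component.\<close>

definition theta :: "'a \<Rightarrow> 'a poly" where
  "theta x = (THE p. (\<forall>i. coeff p i \<in> Rg i) \<and> poly p 1 = x)"

lemma poly_one_eq_sum:
  fixes p :: "'a poly"
  shows "poly p 1 = (\<Sum>i\<in>{i. coeff p i \<noteq> 0}. coeff p i)"
proof -
  have "(\<Sum>i\<in>{i. coeff p i \<noteq> 0}. coeff p i) = (\<Sum>i\<le>degree p. coeff p i)"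
    by (intro sum.mono_neutral_left) (auto intro: le_degree)
  then show ?thesis by (simp add: poly_altdef)
qed

lemma theta_ex1: "\<exists>!p. (\<forall>i. coeff p i \<in> Rg i) \<and> poly p 1 = x"
proof -
  obtain f where f': "(\<forall>i. f i \<in> Rg i) \<and> finite {i. f i \<noteq> 0} \<and> x = (\<Sum>i\<in>{i. f i \<noteq> 0}. f i)"
    and uniq: "\<And>g. (\<forall>i. g i \<in> Rg i) \<and> finite {i. g i \<noteq> 0} \<and> x = (\<Sum>i\<in>{i. g i \<noteq> 0}. g i) \<Longrightarrow> g = f"
    by (rule ex1E[OF decomposition[of x]]) blast
  note f = f'[THEN conjunct1] f'[THEN conjunct2, THEN conjunct1] f'[THEN conjunct2, THEN conjunct2]
  have cf: "coeff (Abs_poly f) = f"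
    using f(2) by (intro Abs_poly_inverse) (simp add: eventually_cofinite)
  show ?thesis
  proof (rule ex1I[of _ "Abs_poly f"])
    show "(\<forall>i. coeff (Abs_poly f) i \<in> Rg i) \<and> poly (Abs_poly f) 1 = x"
      using f by (simp add: poly_one_eq_sum cf)
    fix p assume p: "(\<forall>i. coeff p i \<in> Rg i) \<and> poly p 1 = x"
    have "coeff p = f"
      using p by (intro uniq) (auto simp: poly_one_eq_sum MOST_coeff_eq_0[unfolded eventually_cofinite])
    then show "p = Abs_poly f" by (simp add: poly_eq_iff cf)
  qed
qed

lemma coeff_theta: "coeff (theta x) i \<in> Rg i" and poly_theta_1: "poly (theta x) 1 = x"
  using theI'[OF theta_ex1[of x]] unfolding theta_def by auto

text \<open>Uniqueness of the decomposition reduces every identity for \<open>theta\<close> to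
  checking the degrees of the coefficients and the value at 1.\<close>

lemma theta_eqI: "(\<And>i. coeff p i \<in> Rg i) \<Longrightarrow> poly p 1 = x \<Longrightarrow> theta x = p"
  using theta_ex1[of x] coeff_theta[of x] poly_theta_1[of x] by blast

lemma theta_homog: "x \<in> Rg i \<Longrightarrow> theta x = monom x i"
  by (rule theta_eqI) (auto simp: homog_zero poly_monom)

lemma theta_0: "theta 0 = 0"
  by (rule theta_eqI) (auto simp: homog_zero)

lemma theta_add: "theta (x + y) = theta x + theta y"
  by (rule theta_eqI) (auto simp: homog_add coeff_theta poly_theta_1)

lemma theta_uminus: "theta (- x) = - theta x"
  by (rule theta_eqI) (auto simp: homog_uminus coeff_theta poly_theta_1)

lemma theta_diff: "theta (x - y) = theta x - theta y"
  using theta_add[of x "- y"] by (simp add: theta_uminus)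

lemma theta_mult: "theta (x * y) = theta x * theta y"
proof (rule theta_eqI)
  show "coeff (theta x * theta y) k \<in> Rg k" for k
    unfolding coeff_mult
  proof (rule homog_sum)
    fix i assume "i \<in> {..k}"
    then show "coeff (theta x) i * coeff (theta y) (k - i) \<in> Rg k"
      using homog_mult[OF coeff_theta[of x i] coeff_theta[of y "k - i"]] by simp
  qed
qed (simp add: poly_theta_1)

lemma theta_sum: "theta (sum f A) = (\<Sum>i\<in>A. theta (f i))"
  by (induction A rule: infinite_finite_induct) (auto simp: theta_0 theta_add)

text \<open>For a nonzero homogeneous \<open>x\<close> of degree \<open>i\<close>, compare the
  components of degree \<open>i\<close> in \<open>x * 1 = x\<close> and cancel
  \<open>x\<close>.\<close>

lemma one_homog: "1 \<in> Rg 0"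
proof -
  obtain i x where x: "x \<in> Rg i" "x \<noteq> 0" using nontrivial homog_zero by blast
  have "coeff (theta x) i = coeff (theta x * theta 1) i" by (simp add: theta_mult[symmetric])
  also have "\<dots> = x * coeff (theta 1) 0"
    by (simp add: theta_homog[OF x(1)] coeff_monom_mult)
  finally have "coeff (theta 1) 0 = 1" using x by (simp add: theta_homog)
  then show ?thesis using coeff_theta[of 1 0] by simp
qed

lemma theta_degree_0: "x \<in> Rg 0 \<Longrightarrow> theta x = [:x:]"
  by (simp add: theta_homog monom_0)

lemma theta_1: "theta 1 = 1"
  by (simp add: theta_degree_0 one_homog one_pCons)

section \<open>The projection to degree zero and its kernel\<close>

definition deg0 :: "'a \<Rightarrow> 'a" where "deg0 x = poly (theta x) 0"

lemma deg0_homog: "deg0 x \<in> Rg 0"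
  using coeff_theta[of x 0] by (simp add: deg0_def poly_0_coeff_0)

lemma deg0_id: "x \<in> Rg 0 \<Longrightarrow> deg0 x = x"
  by (simp add: deg0_def theta_degree_0)

lemma deg0_simps: "deg0 0 = 0" "deg0 1 = 1" "deg0 (x + y) = deg0 x + deg0 y" "deg0 (x - y) = deg0 x - deg0 y"
  "deg0 (x * y) = deg0 x * deg0 y" "deg0 (sum f A) = (\<Sum>i\<in>A. deg0 (f i))"
  by (simp_all add: deg0_def theta_0 theta_1 theta_add theta_diff theta_mult theta_sum poly_sum)

lemma deg0_deg0: "deg0 (deg0 x) = deg0 x"
  by (simp add: deg0_id deg0_homog)

lemma Rplus_eq: "Rplus Rg = {x. deg0 x = 0}"
proof (intro set_eqI iffI)
  fix x assume "x \<in> Rplus Rg"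
  then obtain f where f: "\<forall>i. f i \<in> Rg i" "finite {i. f i \<noteq> 0}" "x = (\<Sum>i\<in>{i. f i \<noteq> 0}. f i)" "f 0 = 0"
    unfolding Rplus_def by blast
  have cf: "coeff (Abs_poly f) = f"
    using f(2) by (intro Abs_poly_inverse) (simp add: eventually_cofinite)
  have "theta x = Abs_poly f"
    using f by (intro theta_eqI) (simp_all add: poly_one_eq_sum cf)
  then show "x \<in> {x. deg0 x = 0}" using f(4) by (simp add: deg0_def poly_0_coeff_0 cf)
next
  fix x assume "x \<in> {x. deg0 x = 0}"
  then have "coeff (theta x) 0 = 0" by (simp add: deg0_def poly_0_coeff_0)
  moreover have "x = (\<Sum>i\<in>{i. coeff (theta x) i \<noteq> 0}. coeff (theta x) i)"
    using poly_one_eq_sum[of "theta x"] by (simp add: poly_theta_1)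
  ultimately show "x \<in> Rplus Rg"
    unfolding Rplus_def using coeff_theta MOST_coeff_eq_0[of "theta x", unfolded eventually_cofinite] by blast
qed

section \<open>Graded primes below a prime\<close>

text \<open>For an ideal \<open>P\<close> this is the largest graded ideal contained in
  \<open>P\<close>.\<close>

definition star :: "'a set \<Rightarrow> 'a set" where
  "star P = {x. \<forall>i. coeff (theta x) i \<in> P}"

lemma star_subset:
  assumes "ideal_of UNIV P"
  shows "star P \<subseteq> P"
proof
  fix x assume "x \<in> star P"
  then have "(\<Sum>i\<in>{i. coeff (theta x) i \<noteq> 0}. coeff (theta x) i) \<in> P"
    by (intro ideal_sum[OF assms]) (simp add: star_def)
  then show "x \<in> P" by (simp add: poly_one_eq_sum[symmetric] poly_theta_1)
qed

lemma star_mono: "P \<subseteq> Q \<Longrightarrow> star P \<subseteq> star Q"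
  by (auto simp: star_def)

lemma homog_in_star: "ideal_of UNIV P \<Longrightarrow> x \<in> Rg i \<Longrightarrow> x \<in> star P \<longleftrightarrow> x \<in> P"
  by (auto simp: star_def theta_homog ideal_zero split: if_splits)

lemma in_star_iff: "ideal_of UNIV P \<Longrightarrow> x \<in> star P \<longleftrightarrow> (\<forall>i. coeff (theta x) i \<in> star P)"
  using homog_in_star[OF _ coeff_theta] by (auto simp: star_def)

text \<open>Elements outside \<open>star P\<close> have a top degree modulo \<open>P\<close>; for a
  prime \<open>P\<close> top degrees add, so the product is outside as well.\<close>

lemma star_prime:
  assumes P: "prime_ideal_of UNIV P"
  shows "prime_ideal_of UNIV (star P)"
proof (rule prime_idealI)
  note iP = prime_ideal_ideal[OF P]
  show "ideal_of UNIV (star P)"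
    unfolding ideal_of_UNIV_iff star_def
    by (auto simp: theta_0 theta_add theta_mult coeff_mult ideal_zero[OF iP] intro!: ideal_add[OF iP] ideal_sum[OF iP] ideal_mult_left[OF iP])
  show "1 \<notin> star P" using star_subset[OF iP] prime_ideal_one[OF P] by blast
  fix x y assume xy: "x * y \<in> star P"
  show "x \<in> star P \<or> y \<in> star P"
  proof (rule ccontr)
    assume "\<not> ?thesis"
    then obtain i j where "top_at P (theta x) i" "top_at P (theta y) j"
      unfolding star_def using top_at_exists[OF ideal_zero[OF iP]] by blast
    then have "top_at P (theta (x * y)) (i + j)"
      unfolding theta_mult by (rule top_at_mult[OF P])
    then show False using xy by (auto simp: star_def top_at_def)
  qed
qed

text \<open>Modulo \<open>star P\<close> and after inverting the homogeneous elements outside it, the ring is a graded field, hence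
  at most a ring of Laurent polynomials in one variable. The minimal width element \<open>a\<close> plays the role of a generator
  of \<open>P\<close> in that principal ideal domain.\<close>

lemma no_prime_between_star:
  assumes P: "prime_ideal_of UNIV P" and Q: "prime_ideal_of UNIV Q" and QP: "Q \<subset> P"
    and eq: "star Q = star P"
  shows "Q = star P"
proof (rule ccontr)
  assume "Q \<noteq> star P"
  define p where "p = star P"
  note iP = prime_ideal_ideal[OF P] and iQ = prime_ideal_ideal[OF Q]
  have pp: "prime_ideal_of UNIV p" unfolding p_def by (rule star_prime[OF P])
  note ip = prime_ideal_ideal[OF pp]
  have pQ: "p \<subseteq> Q" using star_subset[OF iQ] eq p_def by simp
  then obtain q0 where q0: "q0 \<in> Q" "q0 \<notin> p" using \<open>Q \<noteq> star P\<close> p_def by blast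
  have hom: "x \<in> p \<longleftrightarrow> x \<in> P" if "x \<in> Rg i" for x i
    unfolding p_def by (rule homog_in_star[OF iP that])
  have notin: "\<exists>i. coeff (theta x) i \<notin> p" if "x \<notin> p" for x
    using that in_star_iff[OF iP, of x] unfolding p_def by blast
  define W where "W x = width p (theta x)" for x
  obtain a where a: "a \<in> P" "a \<notin> p" and amin: "\<And>b. b \<in> P \<Longrightarrow> b \<notin> p \<Longrightarrow> W a \<le> W b"
    using ex_has_least_nat[of "\<lambda>x. x \<in> P \<and> x \<notin> p" q0 W] q0 QP by blast
  obtain q where q: "q \<in> Q" "q \<notin> p" and qmin: "\<And>b. b \<in> Q \<Longrightarrow> b \<notin> p \<Longrightarrow> W q \<le> W b"
    using ex_has_least_nat[of "\<lambda>x. x \<in> Q \<and> x \<notin> p" q0 W] q0 by blast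
  have W_mult: "W (x * y) = W x + W y" if "x \<notin> p" "y \<notin> p" for x y
    using notin[OF that(1)] notin[OF that(2)] width_mult[OF pp] by (auto simp: W_def theta_mult)
  have W_homog: "W x = 0" if "x \<in> Rg i" "x \<notin> p" for x i
  proof -
    have "bot_at p (theta x) i" "top_at p (theta x) i"
      using that by (auto simp: theta_homog bot_at_def top_at_def ideal_zero[OF ip])
    then show ?thesis by (simp add: W_def width_eq)
  qed
  obtain j where j: "top_at p (theta a) j"
    using notin[OF a(2)] top_at_exists[OF ideal_zero[OF ip]] by blast
  obtain i where i: "bot_at p (theta a) i" using notin[OF a(2)] bot_at_exists by blast
  define l where "l = coeff (theta a) j"
  have l: "l \<in> Rg j" "l \<notin> p" using j coeff_theta by (auto simp: l_def top_at_def)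
  \<comment> \<open>Width zero would make \<open>a\<close> homogeneous modulo \<open>p\<close>, but
    homogeneous elements of \<open>P\<close> already lie in \<open>p\<close>.\<close>
  have W_pos: "W a > 0"
  proof (rule ccontr)
    assume "\<not> W a > 0"
    then have "i = j" using width_eq[OF i j] bot_le_top[OF i j] by (simp add: W_def)
    then have "coeff (theta a - monom (coeff (theta a) j) j) k \<in> p" for k
      using i j ideal_zero[OF ip]
      by (cases k j rule: linorder_cases) (auto simp: bot_at_def top_at_def)
    then have "coeff (theta (a - l)) k \<in> p" for k
      using theta_homog[OF l(1)] by (simp add: theta_diff l_def)
    then have "a - l \<in> p" unfolding p_def using in_star_iff[OF iP, of "a - l"] by blast
    then have "a - l \<in> P" using star_subset[OF iP] by (auto simp: p_def)
    then have "a - (a - l) \<in> P" by (rule ideal_diff[OF iP a(1)])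
    then show False using hom[OF l(1)] l(2) by simp
  qed
  have trivial: "\<exists>h c k. h \<in> Rg k \<and> h \<notin> p \<and> h * b - c * a \<in> p" if "b \<in> p" for b
  proof -
    have "1 \<in> Rg 0 \<and> 1 \<notin> p \<and> 1 * b - 0 * a \<in> p" using that one_homog prime_ideal_one[OF pp] by simp
    then show ?thesis by blast
  qed
  \<comment> \<open>Pseudo-division by \<open>a\<close>: the multipliers are homogeneous and outside
    \<open>p\<close>, and the width descends. Minimality of \<open>a\<close> keeps each step
    applicable, so the descent ends only in \<open>p\<close>.\<close>
  have division: "\<exists>h c k. h \<in> Rg k \<and> h \<notin> p \<and> h * b - c * a \<in> p" if "b \<in> P" for b
    using that
  proof (induction "W b" arbitrary: b rule: less_induct)
    case less
    show ?case
    proof (cases "b \<in> p")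
      case True
      then show ?thesis by (rule trivial)
    next
      case False
      obtain m where m: "top_at p (theta b) m"
        using notin[OF False] top_at_exists[OF ideal_zero[OF ip]] by blast
      define b' where "b' = l * b - coeff (theta b) m * a"
      have th: "theta b' = monom (coeff (theta a) j) j * theta b - monom (coeff (theta b) m) m * theta a"
        by (simp add: b'_def theta_diff theta_mult theta_homog[OF coeff_theta] l_def)
      have "b' \<in> P" unfolding b'_def by (intro ideal_diff[OF iP] ideal_mult_left[OF iP] less.prems a(1))
      have "\<exists>h c k. h \<in> Rg k \<and> h \<notin> p \<and> h * b' - c * a \<in> p"
      proof (cases "b' \<in> p")
        case True
        then show ?thesis by (rule trivial)
      next
        case nb: False
        then have "W b' < W b"
          using notin[OF nb] width_pseudo_remainder[OF pp j m _ th] amin[OF less.prems False] by (auto simp: W_def)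
        then show ?thesis using less.hyps \<open>b' \<in> P\<close> by blast
      qed
      then obtain h c k where h: "h \<in> Rg k" "h \<notin> p" "h * b' - c * a \<in> p" by blast
      have "h * l \<in> Rg (k + j)" "h * l \<notin> p"
        using h l homog_mult by (auto simp: prime_ideal_mult_iff[OF pp])
      moreover have "h * b' - c * a = (h * l) * b - (h * coeff (theta b) m + c) * a"
        by (simp add: b'_def algebra_simps)
      then have "(h * l) * b - (h * coeff (theta b) m + c) * a \<in> p" using h(3) by simp
      ultimately show ?thesis by blast
    qed
  qed
  obtain h c k where h: "h \<in> Rg k" "h \<notin> p" "h * q - c * a \<in> p" using division[of q] q QP by blast
  have ca: "c * a \<notin> p"
  proof
    assume "c * a \<in> p"
    then have "(h * q - c * a) + c * a \<in> p" using h(3) by (intro ideal_add[OF ip])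
    then show False using h(2) q(2) by (simp add: prime_ideal_mult_iff[OF pp])
  qed
  have "h * q - c * a \<in> Q" using h(3) pQ by blast
  then have "h * q - (h * q - c * a) \<in> Q" by (rule ideal_diff[OF iQ ideal_mult_left[OF iQ q(1)]])
  \<comment> \<open>If \<open>c \<in> Q\<close>, then \<open>W q = W c + W a\<close> exceeds
    \<open>W c\<close>, against the choice of \<open>q\<close>. If \<open>a \<in> Q\<close>,
    division puts all of \<open>P\<close> into \<open>Q\<close>.\<close>
  then consider "c \<in> Q" | "a \<in> Q" by (auto simp: prime_ideal_mult_iff[OF Q])
  then show False
  proof cases
    case 1
    have cp: "c \<notin> p" using ca by (simp add: prime_ideal_mult_iff[OF pp])
    have "coeff (theta (h * q)) n - coeff (theta (c * a)) n \<in> p" for n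
      using h(3) in_star_iff[OF iP, of "h * q - c * a"] by (simp add: p_def theta_diff)
    then have "coeff (theta (h * q)) n \<in> p \<longleftrightarrow> coeff (theta (c * a)) n \<in> p" for n
      using ideal_add_cancel[OF ip, of "coeff (theta (h * q)) n - coeff (theta (c * a)) n" "coeff (theta (c * a)) n"] by simp
    then have "W (h * q) = W (c * a)" by (simp add: W_def width_def top_at_def bot_at_def)
    then have "W q = W c + W a"
      using W_mult[OF h(2) q(2)] W_mult[OF cp a(2)] W_homog[OF h(1,2)] by simp
    then show False using qmin[OF 1 cp] W_pos by simp
  next
    case 2
    have "P \<subseteq> Q"
    proof
      fix b assume "b \<in> P"
      then obtain h c k where h: "h \<in> Rg k" "h \<notin> p" "h * b - c * a \<in> p" using division by blast
      then have "(h * b - c * a) + c * a \<in> Q" using pQ 2 by (intro ideal_add[OF iQ] ideal_mult_left[OF iQ]) auto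
      then have "h \<in> Q \<or> b \<in> Q" by (simp add: prime_ideal_mult_iff[OF Q])
      then show "b \<in> Q" using h hom QP by blast
    qed
    then show False using QP by blast
  qed
qed

text \<open>Let \<open>Q\<close> be the prime just below the top \<open>P\<close>. If their stars
  differ, the chain found for \<open>star Q\<close> extends by \<open>star P\<close>; if they agree,
  \<open>Q\<close> itself is \<open>star P\<close> and dropping the top suffices.\<close>

lemma chain_to_star:
  assumes "chain_in {P. prime_ideal_of UNIV P} (Suc k) f"
  shows "\<exists>g. chain_in {P. prime_ideal_of UNIV P} k g \<and> g k = star (f (Suc k))"
  using assms
proof (induction k)
  case 0
  then show ?case
    by (intro exI[of _ "\<lambda>_. star (f 1)"]) (auto simp: chain_in_def intro: star_prime)
next
  case (Suc k)
  let ?P = "f (Suc (Suc k))" and ?Q = "f (Suc k)"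
  have f: "chain_in {P. prime_ideal_of UNIV P} (Suc k) f" using Suc.prems by (auto simp: chain_in_def)
  then obtain g where g: "chain_in {P. prime_ideal_of UNIV P} k g" "g k = star ?Q" using Suc.IH by blast
  have PQ: "prime_ideal_of UNIV ?P" "prime_ideal_of UNIV ?Q" "?Q \<subset> ?P"
    using Suc.prems by (auto simp: chain_in_def)
  show ?case
  proof (cases "star ?Q = star ?P")
    case True
    then show ?thesis using no_prime_between_star[OF PQ] f by auto
  next
    case False
    then have "g k \<subset> star ?P" using g(2) star_mono PQ(3) by blast
    then have "chain_in {P. prime_ideal_of UNIV P} (Suc k) (g(Suc k := star ?P))"
      using chain_in_append[OF g(1)] star_prime[OF PQ(1)] by blast
    then show ?thesis by (metis fun_upd_same)
  qed
qed

end

section \<open>Divisibility tools for patching\<close>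

lemma diff_dvd_poly_diff: "c - e dvd poly p c - poly p e" for p :: "'a::comm_ring_1 poly"
proof (induction p)
  case (pCons a p)
  have "poly (pCons a p) c - poly (pCons a p) e = c * (poly p c - poly p e) + (c - e) * poly p e"
    by (simp add: algebra_simps)
  then show ?case using pCons.IH by (simp add: dvd_add)
qed simp

lemma mutual_inverse_cancel:
  fixes s :: "'a::idom"
  assumes XY: "mutual_inverse n (s * s) X Y" and "s \<noteq> 0"
    and X: "\<And>i j. i < n \<Longrightarrow> j < n \<Longrightarrow> X i j = s * Q i j"
    and Y: "\<And>i j. i < n \<Longrightarrow> j < n \<Longrightarrow> Y i j = s * Q' i j"
  shows "mutual_inverse n 1 Q Q'"
  unfolding mutual_inverse_def
proof (intro allI impI)
  fix i j assume ij: "i < n" "j < n"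
  have "mmul n X Y i j = (s * s) * mmul n Q Q' i j" "mmul n Y X i j = (s * s) * mmul n Q' Q i j"
    using X Y ij by (simp_all add: mmul_def sum_distrib_left algebra_simps)
  then have "(s * s) * mmul n Q Q' i j = (s * s) * idm i j" "(s * s) * mmul n Q' Q i j = (s * s) * idm i j"
    using XY ij unfolding mutual_inverse_def by metis+
  then show "mmul n Q Q' i j = 1 * idm i j \<and> mmul n Q' Q i j = 1 * idm i j"
    using assms(2) by simp
qed

section \<open>Polynomial paths of matrices\<close>

lemma poly_mmul: "poly (mmul n A B i j) c = mmul n (\<lambda>i j. poly (A i j) c) (\<lambda>i j. poly (B i j) c) i j"
  by (simp add: mmul_def poly_sum)

lemma poly_idm: "poly (idm i j) c = idm i j"
  by (simp add: idm_def)

lemma mutual_inverse_poly: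
  "mutual_inverse n 1 A B \<Longrightarrow> mutual_inverse n 1 (\<lambda>i j. poly (A i j) c) (\<lambda>i j. poly (B i j) c)"
  unfolding mutual_inverse_def poly_mmul[symmetric] by (simp add: poly_idm)

definition path_equiv :: "nat \<Rightarrow> (nat \<Rightarrow> 'a::comm_ring_1) \<Rightarrow> (nat \<Rightarrow> 'a) \<Rightarrow> bool" where
  "path_equiv n v w \<longleftrightarrow> (\<exists>\<Theta> \<Theta>'. mutual_inverse n 1 \<Theta> \<Theta>' \<and> (\<forall>i<n. \<forall>j<n. poly (\<Theta> i j) 0 = idm i j)
     \<and> (\<forall>j<n. row_mult n v (\<lambda>i j. poly (\<Theta> i j) 1) j = w j))"

lemma path_equiv_trans:
  assumes "path_equiv n v w" "path_equiv n w x"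
  shows "path_equiv n v x"
proof -
  obtain A A' where A: "mutual_inverse n 1 A A'" "\<And>i j. i < n \<Longrightarrow> j < n \<Longrightarrow> poly (A i j) 0 = idm i j"
    "\<And>j. j < n \<Longrightarrow> row_mult n v (\<lambda>i j. poly (A i j) 1) j = w j"
    using assms(1) unfolding path_equiv_def by blast
  obtain B B' where B: "mutual_inverse n 1 B B'" "\<And>i j. i < n \<Longrightarrow> j < n \<Longrightarrow> poly (B i j) 0 = idm i j"
    "\<And>j. j < n \<Longrightarrow> row_mult n w (\<lambda>i j. poly (B i j) 1) j = x j"
    using assms(2) unfolding path_equiv_def by blast
  have "mutual_inverse n 1 (mmul n A B) (mmul n B' A')"
    using mutual_inverse_mmul[OF A(1) B(1)] by simp
  moreover have "poly (mmul n A B i j) 0 = idm i j" if "i < n" "j < n" for i j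
  proof -
    have "poly (mmul n A B i j) 0 = mmul n (\<lambda>i j. 1 * idm i j) idm i j"
      unfolding poly_mmul using A(2) B(2) that by (intro mmul_cong) simp_all
    then show ?thesis using that by (subst (asm) mmul_scalar_left) simp_all
  qed
  moreover have "row_mult n v (\<lambda>i j. poly (mmul n A B i j) 1) j = x j" if "j < n" for j
  proof -
    have "row_mult n v (\<lambda>i j. poly (mmul n A B i j) 1) j
        = row_mult n (row_mult n v (\<lambda>i j. poly (A i j) 1)) (\<lambda>i j. poly (B i j) 1) j"
      unfolding row_mult_mmul poly_mmul ..
    also have "\<dots> = row_mult n w (\<lambda>i j. poly (B i j) 1) j" by (intro row_mult_cong A(3) refl)
    finally show ?thesis using B(3)[OF that] by simp
  qed
  ultimately show ?thesis unfolding path_equiv_def by blast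
qed

text \<open>The path is \<open>Id + T N\<close>, whose second summand still squares to zero.\<close>

lemma path_equiv_nilpotent:
  assumes "\<And>i j. i < n \<Longrightarrow> j < n \<Longrightarrow> mmul n N N i j = 0"
    and "\<And>j. j < n \<Longrightarrow> w j = v j + row_mult n v N j"
  shows "path_equiv n v w"
proof -
  let ?N = "\<lambda>i j. monom (N i j) 1"
  have "mmul n ?N ?N i j = monom (mmul n N N i j) 2" for i j
    by (simp add: mmul_def mult_monom monom_sum numeral_2_eq_2)
  then have "mutual_inverse n 1 (\<lambda>i j. idm i j + ?N i j) (\<lambda>i j. idm i j - ?N i j)"
    using assms(1) by (intro mutual_inverse_nilpotent) simp
  then show ?thesis
    unfolding path_equiv_def using assms(2)
    by (intro exI[of _ "\<lambda>i j. idm i j + ?N i j"] exI[of _ "\<lambda>i j. idm i j - ?N i j"])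
      (simp add: poly_idm poly_monom row_mult_nilpotent)
qed

lemma path_equiv_col_op:
  assumes "a' = a + (\<Sum>i<d. c i * b i)"
  shows "path_equiv (Suc d) (case_nat a b) (case_nat a' b)"
  by (rule path_equiv_nilpotent[of _ "col_op c"])
    (auto simp: col_op_square row_mult_col_op assms split: nat.splits)

lemma path_equiv_row_op:
  assumes "\<And>i. i < d \<Longrightarrow> b' i = b i + a * x i"
  shows "path_equiv (Suc d) (case_nat a b) (case_nat a b')"
  by (rule path_equiv_nilpotent[of _ "row_op x"])
    (auto simp: row_op_square row_mult_row_op assms split: nat.splits)

text \<open>Returning from \<open>w\<close> to \<open>v\<close> takes the inverse path, which again
  starts at the identity.\<close>

lemma path_equiv_imp_H:
  assumes "path_equiv n v w"
  shows "\<exists>\<alpha>\<in>H n. \<forall>j<n. v j = row_mult n w \<alpha> j"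
proof -
  obtain A A' where A: "mutual_inverse n 1 A A'" "\<And>i j. i < n \<Longrightarrow> j < n \<Longrightarrow> poly (A i j) 0 = idm i j"
    "\<And>j. j < n \<Longrightarrow> row_mult n v (\<lambda>i j. poly (A i j) 1) j = w j"
    using assms unfolding path_equiv_def by blast
  let ?\<alpha> = "\<lambda>i j. poly (A' i j) 1" and ?\<beta> = "\<lambda>i j. poly (A i j) 1"
  have \<alpha>: "mutual_inverse n 1 ?\<beta> ?\<alpha>" by (rule mutual_inverse_poly[OF A(1)])
  have "poly (A' i j) 0 = idm i j" if "i < n" "j < n" for i j
  proof -
    have "idm i j = poly (mmul n A A' i j) 0" using A(1) that by (simp add: mutual_inverse_def poly_idm)
    also have "\<dots> = mmul n (\<lambda>i j. 1 * idm i j) (\<lambda>i j. poly (A' i j) 0) i j"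
      unfolding poly_mmul using A(2) that by (intro mmul_cong) simp_all
    also have "\<dots> = poly (A' i j) 0" using that by (subst mmul_scalar_left) simp_all
    finally show ?thesis by simp
  qed
  moreover have "?\<alpha> \<in> GL n" "A' \<in> GL n"
    using \<alpha> A(1) mutual_inverse_commute unfolding GL_iff by blast+
  ultimately have "?\<alpha> \<in> H n" unfolding H_def by blast
  moreover have "v j = row_mult n w ?\<alpha> j" if "j < n" for j
  proof -
    have "row_mult n w ?\<alpha> j = row_mult n (row_mult n v ?\<beta>) ?\<alpha> j"
      using A(3) by (intro row_mult_cong) simp_all
    also have "\<dots> = row_mult n v (\<lambda>i j. 1 * idm i j) j"
      unfolding row_mult_mmul using \<alpha> that by (intro row_mult_cong refl) (simp add: mutual_inverse_def)
    also have "\<dots> = v j" using that by (subst row_mult_scalar) simp_all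
    finally show ?thesis by simp
  qed
  ultimately show ?thesis by blast
qed

lemma H_first_row_unimodular:
  assumes "\<alpha> \<in> H n" "n > 0"
  shows "unimodular n (row_mult n e1 \<alpha>)"
proof -
  obtain \<beta> where "mutual_inverse n 1 \<alpha> \<beta>" using assms(1) unfolding H_def GL_iff by blast
  then have "(\<Sum>k<n. \<alpha> 0 k * \<beta> k 0) = 1" using assms(2) by (simp add: mutual_inverse_def mmul_def idm_def)
  moreover have "row_mult n e1 \<alpha> j = \<alpha> 0 j" for j
    using assms(2) by (simp add: row_mult_def e1_def if_distrib[of "\<lambda>x. x * _"] cong: if_cong)
  ultimately show ?thesis unfolding unimodular_def by auto
qed

section \<open>Dimension estimates\<close>

lemma zero_prime: "prime_ideal_of UNIV {0 :: 'a::idom}"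
  by (rule prime_idealI) (auto simp: ideal_of_UNIV_iff)

text \<open>In a domain the zero ideal can be put below any chain of primes that contain
  \<open>x\<close>.\<close>

lemma no_chain_above_nonzero:
  fixes x :: "'a::idom"
  assumes dim: "\<nexists>f. chain_in {P :: 'a set. prime_ideal_of UNIV P} (Suc d) f" and "x \<in> I" "x \<noteq> 0"
  shows "\<nexists>f. chain_in (spec_on I U) d f"
proof
  assume "\<exists>f. chain_in (spec_on I U) d f"
  then obtain f where f: "chain_in (spec_on I U) d f" by blast
  then have "prime_ideal_of UNIV (f 0)" "x \<in> f 0" using assms(2) by (auto simp: chain_in_def spec_on_def)
  then have "{0} \<subset> f 0" using assms(3) ideal_zero[OF prime_ideal_ideal] by blast
  moreover have "chain_in {P. prime_ideal_of UNIV P} d f"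
    by (rule chain_in_mono[OF f]) (auto simp: spec_on_def)
  ultimately show False using dim chain_in_prepend zero_prime by blast
qed

context graded_domain
begin

lemma deg0_diff_Rplus: "x - deg0 x \<in> Rplus Rg"
  by (simp add: Rplus_eq deg0_simps deg0_deg0)

lemma Rplus_ideal: "ideal_of UNIV (Rplus Rg)"
  by (simp add: Rplus_eq ideal_of_UNIV_iff deg0_simps)

lemma Rplus_nonzero: "\<exists>x\<in>Rplus Rg. x \<noteq> 0"
proof -
  obtain i x where "i \<ge> 1" "x \<in> Rg i" "x \<noteq> 0" using nontrivial homog_zero by blast
  moreover from this have "x \<in> Rplus Rg" by (simp add: Rplus_eq deg0_def theta_homog poly_monom)
  ultimately show ?thesis by blast
qed

text \<open>This prime is \<open>(P \<inter> Rg 0) + R_+\<close>, the pullback of \<open>P\<close>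
  along the retraction \<open>deg0\<close>.\<close>

lemma deg0_preimage_prime:
  assumes P: "prime_ideal_of UNIV P"
  shows "prime_ideal_of UNIV {x. deg0 x \<in> P}"
  using prime_ideal_one[OF P] ideal_zero[OF prime_ideal_ideal[OF P]] ideal_add[OF prime_ideal_ideal[OF P]]
  by (intro prime_idealI) (auto simp: ideal_of_UNIV_iff deg0_simps prime_ideal_mult_iff[OF P])

lemma mult_closed_degree_zero_off_prime:
  assumes "prime_ideal_of UNIV m"
  shows "mult_closed (Rg 0 - m)"
  using one_homog prime_ideal_one[OF assms] homog_mult[of _ 0 _ 0]
  by (auto simp: mult_closed_def prime_ideal_mult_iff[OF assms])

text \<open>Replacing the top \<open>P\<close> of such a chain by \<open>star P\<close> costs at most one step, and
  \<open>star P \<subseteq> {x. deg0 x \<in> P} \<subset> m\<close>; this lengthens the chain beyond the dimension.\<close>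

lemma no_chain_off_degree_zero:
  assumes dim: "\<nexists>f. chain_in {P :: 'a set. prime_ideal_of UNIV P} (Suc d) f" and "d \<ge> 1"
    and m: "prime_ideal_of UNIV m" "Rplus Rg \<subseteq> m" and s: "s \<in> m" "s \<in> Rg 0"
  shows "\<nexists>f. chain_in (spec_on {0} (mult_adjoin (Rg 0 - m) s)) d f"
proof
  note im = prime_ideal_ideal[OF m(1)]
  let ?U = "Rg 0 - m"
  have U: "mult_closed ?U" by (rule mult_closed_degree_zero_off_prime[OF m(1)])
  assume "\<exists>f. chain_in (spec_on {0} (mult_adjoin ?U s)) d f"
  then obtain f where f': "chain_in (spec_on {0} (mult_adjoin ?U s)) d f" by blast
  define P where "P = f d"
  define Z where "Z = {x. deg0 x \<in> P}"
  have f: "chain_in {P. prime_ideal_of UNIV P} d f" by (rule chain_in_mono[OF f']) (auto simp: spec_on_def)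
  have P: "prime_ideal_of UNIV P" and dis: "P \<inter> mult_adjoin ?U s = {}"
    using f' by (auto simp: P_def chain_in_def spec_on_def)
  note iP = prime_ideal_ideal[OF P]
  have PU: "P \<inter> ?U = {}" and sP: "s \<notin> P"
    using dis subset_mult_adjoin[of ?U s] mult_adjoin_self[OF U] by blast+
  have Z: "prime_ideal_of UNIV Z" unfolding Z_def by (rule deg0_preimage_prime[OF P])
  \<comment> \<open>Since \<open>P\<close> misses \<open>Rg 0 - m\<close>, its degree zero elements
    lie in \<open>m\<close>, and so does \<open>Rplus Rg\<close>.\<close>
  have "x \<in> m" if "x \<in> Z" for x
  proof -
    have "deg0 x \<in> m" using that PU deg0_homog by (auto simp: Z_def)
    then have "(x - deg0 x) + deg0 x \<in> m" using deg0_diff_Rplus m(2) by (intro ideal_add[OF im]) blast+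
    then show ?thesis by simp
  qed
  moreover have "s \<notin> Z" using sP s(2) by (simp add: Z_def deg0_id)
  ultimately have Zm: "Z \<subset> m" using s(1) by blast
  have starZ: "star P \<subseteq> Z" by (auto simp: star_def Z_def deg0_def poly_0_coeff_0)
  obtain k where k: "d = Suc k" using \<open>d \<ge> 1\<close> by (cases d) auto
  show False
  proof (cases "star P = Z")
    \<comment> \<open>Here \<open>P\<close> contains \<open>Rplus Rg\<close>, so it lies in
      \<open>Z\<close>, and the chain \<open>f\<close> itself extends by \<open>m\<close>.\<close>
    case True
    have "P \<subseteq> Z"
    proof
      fix x assume "x \<in> P"
      have "x - deg0 x \<in> Z" using ideal_zero[OF iP] by (simp add: Z_def deg0_simps deg0_deg0)
      then have "x - deg0 x \<in> P" using True star_subset[OF iP] by blast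
      then have "x - (x - deg0 x) \<in> P" by (rule ideal_diff[OF iP \<open>x \<in> P\<close>])
      then show "x \<in> Z" by (simp add: Z_def)
    qed
    then have "f d \<subset> m" using Zm by (auto simp: P_def)
    then show False using dim chain_in_append[OF f] m(1) by blast
  next
    case False
    \<comment> \<open>A chain of \<open>d - 1\<close> steps up to \<open>star P\<close>, continued
      by \<open>Z\<close> and \<open>m\<close>, has \<open>d + 1\<close> steps.\<close>
    obtain g where g: "chain_in {P. prime_ideal_of UNIV P} k g" "g k = star P"
      using chain_to_star f unfolding k P_def by blast
    have "chain_in {P. prime_ideal_of UNIV P} d (g(Suc k := Z))"
      unfolding k using starZ False Z by (intro chain_in_append[OF g(1)]) (auto simp: g(2))
    then show False using dim chain_in_append[of _ d "g(Suc k := Z)" m] m(1) Zm unfolding k by auto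
  qed
qed

section \<open>Patching\<close>

text \<open>Evaluating \<open>theta\<close> at \<open>c\<close> is a ring endomorphism that fixes
  degree zero, so the scalar survives.\<close>

lemma mutual_inverse_theta:
  assumes "mutual_inverse n s A B" "s \<in> Rg 0"
  shows "mutual_inverse n s (\<lambda>i j. poly (theta (A i j)) c) (\<lambda>i j. poly (theta (B i j)) c)"
proof -
  have "mmul n (\<lambda>i j. poly (theta (X i j)) c) (\<lambda>i j. poly (theta (Y i j)) c) i j = poly (theta (mmul n X Y i j)) c" for X Y i j
    by (simp add: mmul_def theta_sum theta_mult poly_sum)
  moreover have "poly (theta (s * idm i j)) c = s * idm i j" for i j :: nat
    using assms(2) by (simp add: theta_degree_0 idm_def theta_0)
  ultimately show ?thesis using assms(1) by (simp add: mutual_inverse_def)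
qed

text \<open>The transition matrix is \<open>M'(e) B'(c) / s\<close> with
  \<open>e = c + t * s\<close>. It carries one row to the other because \<open>v M\<close> has
  degree zero and is therefore the same at \<open>e\<close> and at \<open>c\<close>.\<close>

lemma patch_step:
  assumes MB: "mutual_inverse n s M B" and s: "s \<in> Rg 0" "s \<noteq> 0"
    and vM: "\<And>j. j < n \<Longrightarrow> row_mult n v M j \<in> Rg 0"
  shows "row_equiv n {1} (\<lambda>i. poly (theta (v i)) (c + t * s)) (\<lambda>i. poly (theta (v i)) c)"
proof -
  define M' B' v' where "M' e = (\<lambda>i j. poly (theta (M i j)) e)" and "B' e = (\<lambda>i j. poly (theta (B i j)) e)"
    and "v' e = (\<lambda>i. poly (theta (v i)) e)" for e
  have MB': "mutual_inverse n s (M' e) (B' e)" for e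
    unfolding M'_def B'_def by (rule mutual_inverse_theta[OF MB s(1)])
  have v'M': "row_mult n (v' e) (M' e) j = row_mult n v M j" if "j < n" for e j
  proof -
    have "row_mult n (v' e) (M' e) j = poly (theta (row_mult n v M j)) e"
      by (simp add: row_mult_def v'_def M'_def theta_sum theta_mult poly_sum)
    then show ?thesis using vM[OF that] by (simp add: theta_degree_0)
  qed
  \<comment> \<open>\<open>M' e\<close> and \<open>M' e'\<close> agree modulo \<open>s\<close>, and
    \<open>M' e'\<close> times \<open>B' e'\<close> is \<open>s\<close> times the identity.\<close>
  have quot: "\<exists>Q. \<forall>i<n. \<forall>j<n. mmul n (M' e) (B' e') i j = s * Q i j" if "s dvd e - e'" for e e'
  proof -
    have "s dvd M' e i j - M' e' i j" for i j
      unfolding M'_def using that diff_dvd_poly_diff dvd_trans by blast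
    then have "\<exists>D. \<forall>i j. M' e i j = M' e' i j + s * D i j"
      unfolding dvd_def by (metis add.commute diff_add_cancel)
    then obtain D where D: "\<And>i j. M' e i j = M' e' i j + s * D i j" by blast
    have "mmul n (M' e) (B' e') i j = s * (idm i j + mmul n D (B' e') i j)" if "i < n" "j < n" for i j
    proof -
      have "mmul n (M' e) (B' e') i j = mmul n (M' e') (B' e') i j + s * mmul n D (B' e') i j"
        by (simp add: mmul_def D algebra_simps sum.distrib sum_distrib_left)
      then show ?thesis using MB' that by (simp add: mutual_inverse_def distrib_left)
    qed
    then show ?thesis by (intro exI[of _ "\<lambda>i j. idm i j + mmul n D (B' e') i j"]) simp
  qed
  define e where "e = c + t * s"
  obtain Q where Q: "\<And>i j. i < n \<Longrightarrow> j < n \<Longrightarrow> mmul n (M' e) (B' c) i j = s * Q i j"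
    using quot[of e c] by (auto simp: e_def)
  obtain Q' where Q': "\<And>i j. i < n \<Longrightarrow> j < n \<Longrightarrow> mmul n (M' c) (B' e) i j = s * Q' i j"
    using quot[of c e] by (auto simp: e_def)
  have "mutual_inverse n (s * s) (mmul n (M' e) (B' c)) (mmul n (M' c) (B' e))"
    using mutual_inverse_mmul MB' mutual_inverse_commute by blast
  then have "mutual_inverse n 1 Q Q'" by (rule mutual_inverse_cancel) (simp_all add: s(2) Q Q')
  moreover have "row_mult n (v' e) Q j = v' c j" if "j < n" for j
  proof -
    have "s * row_mult n (v' e) Q j = row_mult n (v' e) (mmul n (M' e) (B' c)) j"
      using Q that by (simp add: row_mult_def sum_distrib_left algebra_simps)
    also have "\<dots> = row_mult n (row_mult n (v' e) (M' e)) (B' c) j" by (simp add: row_mult_mmul)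
    also have "\<dots> = row_mult n (row_mult n (v' c) (M' c)) (B' c) j"
      by (rule row_mult_cong) (simp_all add: v'M')
    also have "\<dots> = row_mult n (v' c) (\<lambda>i j. s * idm i j) j"
      unfolding row_mult_mmul using MB' that by (intro row_mult_cong refl) (simp add: mutual_inverse_def)
    also have "\<dots> = s * v' c j" using that by (rule row_mult_scalar)
    finally show ?thesis using s(2) by simp
  qed
  ultimately show ?thesis unfolding row_equiv_def v'_def e_def by blast
qed

text \<open>If the patching ideal were contained in a prime \<open>m\<close>, the local step at
  \<open>Rg 0 - m\<close> would produce an element of that ideal outside \<open>m\<close>.\<close>

lemma row_equiv_deg0:
  assumes dim: "\<nexists>f. chain_in {P :: 'a set. prime_ideal_of UNIV P} (Suc d) f" and "d \<ge> 1"
    and dim0: "krull_dim_ge (Rg 0) 1" and v: "unimodular (Suc d) v"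
  shows "row_equiv (Suc d) {1} v (\<lambda>i. deg0 (v i))"
proof -
  \<comment> \<open>Quillen's ideal, pulled back along \<open>deg0\<close> so that it is an ideal of
    the whole ring and contains \<open>Rplus Rg\<close>.\<close>
  define J where "J = {x. \<forall>t c. row_equiv (Suc d) {1}
    (\<lambda>i. poly (theta (v i)) (c + t * deg0 x)) (\<lambda>i. poly (theta (v i)) c)}"
  have mc: "mult_closed {1::'a}" by (simp add: mult_closed_def)
  have refl: "row_equiv (Suc d) {1} w w" for w :: "nat \<Rightarrow> 'a"
    using row_equiv_scale[of 1 "{1}" "Suc d" w "{}"] by simp
  have J: "ideal_of UNIV J"
    unfolding ideal_of_UNIV_iff
  proof (intro conjI ballI allI)
    show "0 \<in> J" by (simp add: J_def deg0_simps refl)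
  next
    fix x y assume xy: "x \<in> J" "y \<in> J"
    show "x + y \<in> J"
      unfolding J_def
    proof (intro CollectI allI)
      fix t c
      have "row_equiv (Suc d) {1} (\<lambda>i. poly (theta (v i)) ((c + t * deg0 x) + t * deg0 y)) (\<lambda>i. poly (theta (v i)) (c + t * deg0 x))"
        "row_equiv (Suc d) {1} (\<lambda>i. poly (theta (v i)) (c + t * deg0 x)) (\<lambda>i. poly (theta (v i)) c)"
        using xy unfolding J_def by blast+
      then show "row_equiv (Suc d) {1} (\<lambda>i. poly (theta (v i)) (c + t * deg0 (x + y))) (\<lambda>i. poly (theta (v i)) c)"
        using row_equiv_trans[OF mc] by (simp add: deg0_simps distrib_left add.assoc)
    qed
  next
    fix r x assume "x \<in> J"
    then show "r * x \<in> J" by (simp add: J_def deg0_simps mult.assoc[symmetric])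
  qed
  have RJ: "Rplus Rg \<subseteq> J" by (auto simp: J_def Rplus_eq refl)
  have "1 \<in> J"
  proof (rule ccontr)
    assume "1 \<notin> J"
    \<comment> \<open>A strict inclusion of primes provides a nonzero nonunit \<open>s0\<close> of
      \<open>Rg 0\<close>.\<close>
    obtain P0 P1 where P01: "prime_ideal_of (Rg 0) P0" "prime_ideal_of (Rg 0) P1" "P0 \<subset> P1"
      using dim0 unfolding krull_dim_ge_def by (metis One_nat_def le0 le_refl lessI)
    then obtain s0 where "s0 \<in> P1" "s0 \<notin> P0" by blast
    then have s0: "s0 \<in> Rg 0" "s0 \<noteq> 0" using P01 by (auto simp: prime_ideal_of_def ideal_of_def)
    have s0_nonunit: "r * s0 \<noteq> 1" if "r \<in> Rg 0" for r
    proof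
      assume "r * s0 = 1"
      then have "1 \<in> P1" using \<open>s0 \<in> P1\<close> P01(2) that unfolding prime_ideal_of_def ideal_of_def by metis
      then have "r \<in> P1" if "r \<in> Rg 0" for r
        using P01(2) that unfolding prime_ideal_of_def ideal_of_def by (metis mult.right_neutral)
      then show False using P01(2) unfolding prime_ideal_of_def ideal_of_def by blast
    qed
    \<comment> \<open>If \<open>J\<close> and \<open>s0\<close> generate a proper ideal, take
      \<open>s = s0\<close>. Otherwise \<open>1 = r * s0 + z\<close>; in degree zero this shows
      \<open>deg0 z \<noteq> 0\<close>, as \<open>s0\<close> is no unit, and \<open>deg0 z\<close>
      serves as \<open>s\<close>.\<close>
    have "\<exists>m s. prime_ideal_of UNIV m \<and> J \<subseteq> m \<and> s \<in> m \<and> s \<in> Rg 0 \<and> s \<noteq> 0"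
    proof (cases "1 \<in> ideal_join 1 (\<lambda>_. s0) J")
      case False
      then obtain m where "prime_ideal_of UNIV m" "ideal_join 1 (\<lambda>_. s0) J \<subseteq> m"
        using exists_prime_avoiding[OF ideal_join_ideal[OF J] mc] by blast
      moreover have "s0 \<in> ideal_join 1 (\<lambda>_. s0) J" using ideal_join_generator[OF J, of 0 1 "\<lambda>_. s0"] by simp
      ultimately show ?thesis using s0 ideal_join_superset[of J 1 "\<lambda>_. s0"] by blast
    next
      case True
      then obtain r z where rz: "1 = r * s0 + z" "z \<in> J" unfolding ideal_join_single by blast
      have "1 = deg0 r * s0 + deg0 z" using arg_cong[OF rz(1), of deg0] s0(1) by (simp add: deg0_simps deg0_id)
      then have "deg0 z \<noteq> 0" using s0_nonunit[OF deg0_homog, of r] by auto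
      moreover have "deg0 z \<in> J" using rz(2) by (simp add: J_def deg0_deg0)
      moreover obtain m where "prime_ideal_of UNIV m" "J \<subseteq> m"
        using exists_prime_avoiding[OF J mc] \<open>1 \<notin> J\<close> by blast
      ultimately show ?thesis using deg0_homog by blast
    qed
    then obtain m s where m: "prime_ideal_of UNIV m" "J \<subseteq> m" and s: "s \<in> m" "s \<in> Rg 0" "s \<noteq> 0" by blast
    let ?U = "Rg 0 - m"
    have U: "mult_closed ?U" by (rule mult_closed_degree_zero_off_prime[OF m(1)])
    have "s \<in> {r * s | r. True}" by (auto intro: exI[of _ 1])
    then have closed: "\<nexists>f. chain_in (spec_on {r * s | r. True} ?U) d f"
      using s(3) by (rule no_chain_above_nonzero[OF dim])
    have off: "\<nexists>f. chain_in (spec_on {0} (mult_adjoin ?U s)) d f"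
      using RJ m by (intro no_chain_off_degree_zero[OF dim \<open>d \<ge> 1\<close> m(1) _ s(1,2)]) blast
    obtain u where u: "u \<in> ?U" "row_equiv (Suc d) ?U v (case_nat u (\<lambda>_. 0))"
      using local_reduction[OF U closed off v] by blast
    then obtain M B u1 where M: "u1 \<in> ?U" "mutual_inverse (Suc d) u1 M B"
      "\<And>j. j < Suc d \<Longrightarrow> row_mult (Suc d) v M j = case_nat u (\<lambda>_. 0) j"
      unfolding row_equiv_def by blast
    \<comment> \<open>The target row \<open>(u, 0, ..., 0)\<close> has degree zero because
      \<open>?U\<close> lies in \<open>Rg 0\<close>; so patching applies with the scalar
      \<open>u1\<close>.\<close>
    have "row_mult (Suc d) v M j \<in> Rg 0" if "j < Suc d" for j
      using M(3)[OF that] u(1) homog_zero by (auto split: nat.splits)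
    moreover have "u1 \<noteq> 0" using M(1) ideal_zero[OF prime_ideal_ideal[OF m(1)]] by blast
    ultimately have "u1 \<in> J"
      using patch_step[OF M(2)] M(1) by (simp add: J_def deg0_id)
    then show False using M(1) m(2) by blast
  qed
  \<comment> \<open>The endomorphisms at 1 and at 0 are the identity and
    \<open>deg0\<close>.\<close>
  then have "row_equiv (Suc d) {1} (\<lambda>i. poly (theta (v i)) (0 + 1 * deg0 1)) (\<lambda>i. poly (theta (v i)) 0)"
    unfolding J_def by blast
  then show ?thesis by (simp add: deg0_simps poly_theta_1 deg0_def[symmetric])
qed

text \<open>\<open>M\<close> is corrected by the inverse of its degree zero part. Applying
  \<open>deg0\<close> to \<open>v M = deg0 v\<close> shows that this part fixes the target row, so
  the correction does not move it.\<close>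

lemma normalized_reduction:
  assumes "row_equiv n {1} v (\<lambda>i. deg0 (v i))"
  shows "\<exists>\<alpha> \<beta>. mutual_inverse n 1 \<alpha> \<beta> \<and> (\<forall>i<n. \<forall>j<n. deg0 (\<alpha> i j) = idm i j)
    \<and> (\<forall>j<n. row_mult n v \<alpha> j = deg0 (v j))"
proof -
  obtain M B where MB: "mutual_inverse n 1 M B" and vM: "\<And>j. j < n \<Longrightarrow> row_mult n v M j = deg0 (v j)"
    using assms unfolding row_equiv_def by blast
  let ?M = "\<lambda>i j. deg0 (M i j)" and ?B = "\<lambda>i j. deg0 (B i j)" and ?v = "\<lambda>i. deg0 (v i)"
  have MB0: "mutual_inverse n 1 ?M ?B"
    using mutual_inverse_theta[OF MB one_homog, of 0] unfolding deg0_def .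
  have "mutual_inverse n 1 (mmul n M ?B) (mmul n ?M B)"
    using mutual_inverse_mmul[OF MB mutual_inverse_commute[THEN iffD1, OF MB0]] by simp
  moreover have "deg0 (mmul n M ?B i j) = idm i j" if "i < n" "j < n" for i j
    using MB0 that by (simp add: mutual_inverse_def mmul_def deg0_simps deg0_deg0)
  moreover have "row_mult n v (mmul n M ?B) j = deg0 (v j)" if "j < n" for j
  proof -
    have fixed: "row_mult n ?v ?M j = deg0 (v j)" if "j < n" for j
      using arg_cong[OF vM[OF that], of deg0] by (simp add: row_mult_def deg0_simps deg0_deg0)
    have "row_mult n v (mmul n M ?B) j = row_mult n (row_mult n v M) ?B j" by (simp add: row_mult_mmul)
    also have "\<dots> = row_mult n (row_mult n ?v ?M) ?B j" by (rule row_mult_cong) (simp_all add: vM fixed)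
    also have "\<dots> = row_mult n ?v (\<lambda>i j. 1 * idm i j) j"
      unfolding row_mult_mmul using MB0 that by (intro row_mult_cong refl) (simp add: mutual_inverse_def)
    also have "\<dots> = deg0 (v j)" using that by (subst row_mult_scalar) simp_all
    finally show ?thesis .
  qed
  ultimately show ?thesis by blast
qed

text \<open>\<open>theta\<close> applied to the entries of \<open>\<alpha>\<close> is a path from
  the identity to \<open>\<alpha>\<close>.\<close>

lemma path_equiv_deg0:
  assumes "mutual_inverse n 1 \<alpha> \<beta>" "\<And>i j. i < n \<Longrightarrow> j < n \<Longrightarrow> deg0 (\<alpha> i j) = idm i j"
    and "\<And>j. j < n \<Longrightarrow> row_mult n v \<alpha> j = deg0 (v j)"
  shows "path_equiv n v (\<lambda>i. deg0 (v i))"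
  unfolding path_equiv_def
proof (intro exI conjI allI impI)
  have "mmul n (\<lambda>i j. theta (X i j)) (\<lambda>i j. theta (Y i j)) i j = theta (mmul n X Y i j)" for X Y i j
    by (simp add: mmul_def theta_sum theta_mult)
  moreover have "theta (idm i j) = idm i j" for i j :: nat by (simp add: idm_def theta_0 theta_1)
  ultimately show "mutual_inverse n 1 (\<lambda>i j. theta (\<alpha> i j)) (\<lambda>i j. theta (\<beta> i j))"
    using assms(1) by (simp add: mutual_inverse_def)
qed (use assms(2,3) in \<open>simp_all add: deg0_def poly_theta_1\<close>)

text \<open>Primes over \<open>Rplus Rg\<close> are those of \<open>Rg 0\<close>; their chains have
  fewer than \<open>d\<close> steps because \<open>Rplus Rg\<close> is nonzero. So Heitmann's lemma
  shortens the row within degree zero.\<close>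

lemma path_equiv_e1:
  assumes dim: "\<nexists>f. chain_in {P :: 'a set. prime_ideal_of UNIV P} (Suc d) f"
    and v: "unimodular (Suc d) v" and v0: "\<And>i. v i \<in> Rg 0"
  shows "path_equiv (Suc d) v e1"
proof -
  define a b where "a = v 0" and "b = (\<lambda>i. v (Suc i))"
  have vab: "v = case_nat a b" by (auto simp: a_def b_def split: nat.splits)
  have mc: "mult_closed {1::'a}" by (simp add: mult_closed_def)
  have "\<nexists>f. chain_in (spec_on (Rplus Rg) {1}) d f"
    using no_chain_above_nonzero[OF dim] Rplus_nonzero by blast
  then obtain x where x: "\<And>P. P \<in> spec_on (Rplus Rg) {1} \<Longrightarrow> (\<And>i. i < d \<Longrightarrow> b i + a * x i \<in> P) \<Longrightarrow> a \<in> P"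
    using heitmann[OF mc Rplus_ideal, of d b a] by blast
  \<comment> \<open>\<open>deg0 (x i)\<close> keeps the row in degree zero and agrees with
    \<open>x i\<close> modulo \<open>Rplus Rg\<close>, which lies in every prime at hand.\<close>
  define b' where "b' = (\<lambda>i. b i + a * deg0 (x i))"
  have "ideal_join d b' (Rplus Rg) \<inter> {1} \<noteq> {}"
  proof
    assume "ideal_join d b' (Rplus Rg) \<inter> {1} = {}"
    then obtain P where P: "prime_ideal_of UNIV P" "ideal_join d b' (Rplus Rg) \<subseteq> P" "P \<inter> {1} = {}"
      using exists_prime_avoiding[OF ideal_join_ideal[OF Rplus_ideal] mc, of d b'] by blast
    note iP = prime_ideal_ideal[OF P(1)]
    have RP: "Rplus Rg \<subseteq> P" using P(2) ideal_join_superset by blast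
    have b'P: "b' i \<in> P" if "i < d" for i using ideal_join_generator[OF Rplus_ideal that] P(2) by blast
    have "b i + a * x i \<in> P" if "i < d" for i
    proof -
      have "b' i + a * (x i - deg0 (x i)) \<in> P"
        using RP deg0_diff_Rplus by (intro ideal_add[OF iP] b'P[OF that] ideal_mult_left[OF iP]) blast
      then show ?thesis by (simp add: b'_def algebra_simps)
    qed
    then have "a \<in> P" using x[of P] P RP by (auto simp: spec_on_def)
    moreover have "b i \<in> P" if "i < d" for i
      using b'P[OF that] ideal_add_cancel[OF iP, of "a * deg0 (x i)" "b i"] ideal_mult_right[OF iP \<open>a \<in> P\<close>]
      by (simp add: b'_def)
    ultimately show False using unimodular_not_in_prime[OF v P(1)] by (auto simp: a_def b_def)
  qed
  then obtain c z where cz: "1 = (\<Sum>i<d. c i * b' i) + z" "z \<in> Rplus Rg" unfolding ideal_join_def by auto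
  have "deg0 (b' i) = b' i" for i
    using v0 by (simp add: b'_def a_def b_def deg0_simps deg0_deg0 deg0_id)
  \<comment> \<open>Taking degree zero parts removes \<open>z\<close> and leaves an exact
    relation.\<close>
  then have one: "1 = (\<Sum>i<d. deg0 (c i) * b' i)"
    using arg_cong[OF cz(1), of deg0] cz(2) by (simp add: deg0_simps Rplus_eq)
  have "(\<Sum>i<d. ((1 - a) * deg0 (c i)) * b' i) = (1 - a) * (\<Sum>i<d. deg0 (c i) * b' i)"
    by (simp add: sum_distrib_left mult.assoc)
  then have a1: "1 = a + (\<Sum>i<d. ((1 - a) * deg0 (c i)) * b' i)" using one by simp
  note [trans] = path_equiv_trans
  have "path_equiv (Suc d) v (case_nat a b')"
    unfolding vab by (rule path_equiv_row_op[of _ _ _ _ "\<lambda>i. deg0 (x i)"]) (simp add: b'_def)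
  also have "path_equiv (Suc d) (case_nat a b') (case_nat 1 b')"
    by (rule path_equiv_col_op[OF a1])
  also have "path_equiv (Suc d) (case_nat 1 b') (case_nat 1 (\<lambda>_. 0))"
    by (rule path_equiv_row_op[of _ _ _ _ "\<lambda>i. - b' i"]) simp
  also have "case_nat 1 (\<lambda>_. 0) = (e1 :: nat \<Rightarrow> 'a)"
    by (auto simp: e1_def split: nat.splits)
  finally show ?thesis .
qed

end

theorem mainTheorem7:
  fixes Rg :: "nat \<Rightarrow> 'a::idom set" and d :: nat
  assumes "noetherian_ring TYPE('a)"
    and "graded_ring Rg"
    and "has_krull_dim (UNIV :: 'a set) d"
    and "d \<ge> 2"
    and "krull_dim_ge (Rg 0) 1"
  shows "(\<forall>v \<in> Um_rel (d + 1) (Rplus Rg). \<exists>\<alpha> \<in> GL_rel (d + 1) (Rplus Rg).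
            \<forall>j<d + 1. row_mult (d + 1) v \<alpha> j = e1 j)
     \<and> (\<forall>v :: nat \<Rightarrow> 'a. unimodular (d + 1) v \<longrightarrow>
            (\<exists>\<alpha> \<in> (H (d + 1) :: (nat \<Rightarrow> nat \<Rightarrow> 'a) set). \<forall>j<d + 1. v j = row_mult (d + 1) e1 \<alpha> j))
     \<and> (\<forall>\<alpha> \<in> (H (d + 1) :: (nat \<Rightarrow> nat \<Rightarrow> 'a) set). unimodular (d + 1) (row_mult (d + 1) e1 \<alpha>))"
proof -
  interpret graded_domain Rg by unfold_locales (rule assms(2))
  have dim: "\<nexists>f. chain_in {P :: 'a set. prime_ideal_of UNIV P} (Suc d) f"
    using assms(3) by (simp add: has_krull_dim_def krull_dim_ge_chain)
  have reduction: "\<exists>\<alpha> \<beta>. mutual_inverse (Suc d) 1 \<alpha> \<beta> \<and> (\<forall>i<Suc d. \<forall>j<Suc d. deg0 (\<alpha> i j) = idm i j)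
      \<and> (\<forall>j<Suc d. row_mult (Suc d) v \<alpha> j = deg0 (v j))" if "unimodular (Suc d) v" for v
    using row_equiv_deg0[OF dim _ assms(5) that] assms(4) by (intro normalized_reduction) simp
  have relative: "\<exists>\<alpha>\<in>GL_rel (Suc d) (Rplus Rg). \<forall>j<Suc d. row_mult (Suc d) v \<alpha> j = e1 j"
    if Um: "v \<in> Um_rel (Suc d) (Rplus Rg)" for v
  proof -
    have deg0_e1: "deg0 (e1 j) = e1 j" for j by (simp add: e1_def deg0_simps)
    have deg0_idm: "deg0 (idm i j) = idm i j" for i j by (simp add: idm_def deg0_simps)
    \<comment> \<open>Congruence to \<open>e1\<close> modulo \<open>Rplus Rg\<close> says that the
      degree zero part is \<open>e1\<close>; likewise for matrices and the identity.\<close>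
    have "deg0 (v j) = e1 j" if "j < Suc d" for j
      using Um that by (auto simp: Um_rel_def Rplus_eq deg0_simps deg0_e1)
    moreover obtain \<alpha> \<beta> where "mutual_inverse (Suc d) 1 \<alpha> \<beta>"
      "\<forall>i<Suc d. \<forall>j<Suc d. deg0 (\<alpha> i j) = idm i j" "\<forall>j<Suc d. row_mult (Suc d) v \<alpha> j = deg0 (v j)"
      using reduction[of v] Um unfolding Um_rel_def by blast
    ultimately show ?thesis
      by (intro bexI[of _ \<alpha>]) (auto simp: GL_rel_def GL_iff Rplus_eq deg0_simps deg0_idm)
  qed
  have absolute: "\<exists>\<alpha>\<in>H (Suc d). \<forall>j<Suc d. v j = row_mult (Suc d) e1 \<alpha> j"
    if v: "unimodular (Suc d) v" for v :: "nat \<Rightarrow> 'a"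
  proof -
    obtain w where "(\<Sum>i<Suc d. v i * w i) = 1" using v unfolding unimodular_def by blast
    from arg_cong[OF this, of deg0] have "unimodular (Suc d) (\<lambda>i. deg0 (v i))"
      unfolding unimodular_def deg0_simps by (rule exI[of _ "\<lambda>i. deg0 (w i)"])
    \<comment> \<open>The path from \<open>v\<close> to its degree zero part is followed by one from
      there to \<open>e1\<close>.\<close>
    then have "path_equiv (Suc d) (\<lambda>i. deg0 (v i)) e1"
      using path_equiv_e1[OF dim] deg0_homog by blast
    moreover have "path_equiv (Suc d) v (\<lambda>i. deg0 (v i))"
      using reduction[OF v] path_equiv_deg0 by blast
    ultimately show ?thesis using path_equiv_trans path_equiv_imp_H by blast
  qed
  have "unimodular (Suc d) (row_mult (Suc d) e1 \<alpha>)" if "\<alpha> \<in> H (Suc d)" for \<alpha> :: "nat \<Rightarrow> nat \<Rightarrow> 'a"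
    using H_first_row_unimodular[OF that] by simp
  then show ?thesis using relative absolute by simp
qed

end
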